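(* As $n\to\infty$, the following asymptotic behavior of $K_j$ and $R_j$ given $N(\widehat{\Lambda}_j)=n$ holds. (i) For any $x>0$, $$\lim_{n\to\infty}\mathbb P\bigl[K_j\le x\sqrt n\,\big|\,N(\widehat{\Lambda}_j)=n\bigr]=\int_0^x\frac{y\,\mathrm e^{-\pi y/\sqrt6}\,dy}{1-\mathrm e^{-\pi y/\sqrt6}}.$$ (ii) For any $x>0$, any sequence of positive integers $k_n$ such that $\lim_{n\to\infty}k_n/\sqrt n=x$, and each $r=1,2,\dots$, $$\lim_{n\to\infty}\mathbb P\bigl[R_j=r\,\big|\,K_j=k_n,\,N(\widehat{\Lambda}_j)=n\bigr]=\bigl(1-\mathrm e^{-\pi x/\sqrt6}\bigr)\mathrm e^{-\pi x(r-1)/\sqrt6}.$$ (iii) $$\lim_{n\to\infty}\frac{\mathbb E\bigl[K_jR_j\,\big|\,N(\widehat{\Lambda}_j)=n\bigr]}{\sqrt n}=\frac{2\sqrt6}{\pi};$$ moreover, for any $\nu=1,2,\dots$, $\ \mathbb E\bigl[(K_jR_j)^\nu\,\big|\,N(\widehat{\Lambda}_j)=n\bigr]=O(n^{\nu/2})$ as $n\to\infty$. (iv) For any $x>0$, $$\lim_{n\to\infty}\mathbb E\bigl[R_j\mathbf 1_{\{K_j\ge x\sqrt n\}}\,\big|\,N(\widehat{\Lambda}_j)=n\bigr]=h(x),\qquad h(x)=\frac{\sqrt6\,x\,\mathrm e^{-\pi x/\sqrt6}}{\pi(1-\mathrm e^{-\pi x/\sqrt6})}-\frac{6\log(1-\mathrm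 e^{-\pi x/\sqrt6})}{\pi^2}.$$
   Context: For an integer partition $\lambda$, $N(\lambda)$ is the sum of its parts and $C_k(\lambda)$ is the number of parts equal to $k$. $(\widehat{\Lambda}_j)_{j\ge0}$ is the Markov chain on the set of all integer partitions started at the empty partition $\widehat{\Lambda}_0=\varnothing$, which at each step adds to the current partition $\mu$ of weight $n=N(\mu)$ some number $r\ge1$ of parts all equal to some $k\ge1$, with probability $\dfrac{k\,g(n+kr)}{(n+kr)\,g(n)}$. Here $g(0)=1$ and, for $n\ge1$, $$g(n)=\sum_{k=-\infty}^\infty\frac{(-1)^kn}{n+\frac{k(3k+1)}2}=\frac{8\sqrt3\,\pi n\sinh\left(\frac{\pi\sqrt{24n-1}}6\right)}{\sqrt{24n-1}\left(2\cosh\left(\frac{\pi\sqrt{24n-1}}3\right)-1\right)}.$$ $(K_j,R_j)$ denotes the pair (part size, number of parts added) at the step from $\widehat{\Lambda}_j$ to $\widehat{\Lambda}_{j+1}$, i.e. $C_{K_j}(\widehat{\Lambda}_{j+1})=C_{K_j}(\widehat{\Lambda}_j)+R_j$ and the other part counts are unchanged. Thus the conditional law of $(K_j,R_j)$ given $N(\widehat{\Lambda}_j)=n$ does not depend on $j$: $$\mathbb P[K_j=k,R_j=r\mid N(\widehat{\Lambda}_j)=n]=\frac{k\,g(n+kr)}{(n+kr)\,g(n)},\qquad k,r=1,2,\dots$$ $\mathbf 1_A$ is the indicator of an event $A$. *)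

theory Defs
  imports "HOL-Probability.Probability" "HOL-Library.Multiset" "HOL-Library.Landau_Symbols"
begin

text \<open>An integer partition is a multiset of positive natural numbers: its weight is
  \<^term>\<open>sum_mset\<close> and the number of parts equal to k is \<^term>\<open>count\<close> at k.\<close>

definition partitions :: "nat multiset set" where
  "partitions = {\<mu>. 0 \<notin># \<mu>}"

text \<open>The defining series converges absolutely, so the unordered sum over all integers is
  the two-sided series.\<close>

definition g :: "nat \<Rightarrow> real" where
  "g n = (if n = 0 then 1
          else (\<Sum>\<^sub>\<infinity>k::int. (-1) powi k * real n / (real n + real_of_int (k * (3 * k + 1)) / 2)))"

definition step_prob :: "nat \<Rightarrow> nat \<Rightarrow> nat \<Rightarrow> real" where
  "step_prob n k r = real k * g (n + k * r) / (real (n + k * r) * g n)"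

definition adds_parts :: "nat multiset \<Rightarrow> nat multiset \<Rightarrow> nat \<Rightarrow> nat \<Rightarrow> bool" where
  "adds_parts \<mu> \<nu> k r \<longleftrightarrow> k \<ge> 1 \<and> r \<ge> 1 \<and> \<nu> = \<mu> + replicate_mset r k"

text \<open>Any realization, on an arbitrary probability space, of the Markov chain started at the
  empty partition. The Markov property is conditioning on the whole past path, whenever that
  path has positive probability.\<close>

locale partition_chain = prob_space M for M :: "'a measure" +
  fixes \<Lambda> :: "nat \<Rightarrow> 'a \<Rightarrow> nat multiset"
  assumes measurable_chain: "\<And>j. \<Lambda> j \<in> measurable M (count_space partitions)"
    and start: "AE \<omega> in M. \<Lambda> 0 \<omega> = {#}"
    and step: "\<And>j. AE \<omega> in M. \<exists>k r. adds_parts (\<Lambda> j \<omega>) (\<Lambda> (Suc j) \<omega>) k r"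
    and transition: "\<And>j x k r. \<lbrakk>\<P>(\<omega> in M. \<forall>i\<le>j. \<Lambda> i \<omega> = x i) > 0; k \<ge> 1; r \<ge> 1\<rbrakk> \<Longrightarrow>
      \<P>(\<omega> in M. \<Lambda> (Suc j) \<omega> = x j + replicate_mset r k \<bar> \<forall>i\<le>j. \<Lambda> i \<omega> = x i)
        = step_prob (sum_mset (x j)) k r"

text \<open>The pair (part size, number of parts added) at the step from index j to j + 1. It is
  uniquely determined by that step, hence well defined almost surely.\<close>

definition K :: "(nat \<Rightarrow> 'a \<Rightarrow> nat multiset) \<Rightarrow> nat \<Rightarrow> 'a \<Rightarrow> nat" where
  "K \<Lambda> j \<omega> = (THE k. \<exists>r. adds_parts (\<Lambda> j \<omega>) (\<Lambda> (Suc j) \<omega>) k r)"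

definition R :: "(nat \<Rightarrow> 'a \<Rightarrow> nat multiset) \<Rightarrow> nat \<Rightarrow> 'a \<Rightarrow> nat" where
  "R \<Lambda> j \<omega> = (THE r. \<exists>k. adds_parts (\<Lambda> j \<omega>) (\<Lambda> (Suc j) \<omega>) k r)"

text \<open>Conditioning on the event that the j-th partition has weight n (assumed to have
  positive probability).\<close>

definition cond_measure :: "'a measure \<Rightarrow> (nat \<Rightarrow> 'a \<Rightarrow> nat multiset) \<Rightarrow> nat \<Rightarrow> nat \<Rightarrow> 'a measure" where
  "cond_measure M \<Lambda> j n = uniform_measure M {\<omega> \<in> space M. sum_mset (\<Lambda> j \<omega>) = n}"

end

theory Submission
  imports Defs "HOL-Real_Asymp.Real_Asymp"
begin

text \<open>
  The step probabilities are \<open>k u(n + k r) / (n u(n))\<close> with \<open>u(m) = g(m) / m\<close>. The alternating series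
  for \<open>u\<close> is the partial fraction expansion of the cosecant at \<open>z = 1/6 + i sqrt (24 n - 1) / 6\<close>, which
  gives the closed form of \<open>g\<close> (\<open>g_closed_form\<close>). Hence \<open>u(m)\<close> decays like \<open>exp (- 2 pi sqrt (m / 6)) / sqrt m\<close>,
  and for \<open>k\<close> close to \<open>x sqrt n\<close> the exponent at \<open>n + k r\<close> exceeds the one at \<open>n\<close> by about
  \<open>pi x r / sqrt 6\<close>: the step probability, multiplied by \<open>sqrt n\<close>, tends to \<open>x exp (- pi x r / sqrt 6)\<close>
  (\<open>step_prob_tendsto\<close>). It is also bounded, uniformly in \<open>n\<close>, by a constant times \<open>y / (1 + r y)^p\<close> with
  \<open>y = k / sqrt n\<close>, for every power \<open>p\<close> (\<open>step_prob_le\<close>).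

  So \<open>(K / sqrt n, R)\<close> has a limit law on \<open>(0, \<infinity>) \<times> {1, 2, ...}\<close> with density
  \<open>y exp (- pi y r / sqrt 6)\<close>, and expectations of functions of polynomial growth in \<open>K R / sqrt n\<close> converge
  to the corresponding integrals (\<open>step_sum_tendsto\<close>): the sum over \<open>r\<close> is treated by
  Tannery's theorem, the sum over \<open>k\<close> by dominated convergence for step functions of \<open>y\<close>. The
  distribution function of \<open>K\<close>, the moments of \<open>K R\<close>, and the truncated mean of \<open>R\<close>, in which
  \<open>R \<le> (K R / sqrt n) / x\<close>, are all of this kind; their limits are evaluated by geometric series,
  \<open>zeta(2)\<close>, and an explicit antiderivative. The conditional law of \<open>R\<close> given \<open>K\<close> follows from the
  local limit and the limit of the row sums.

  These are statements about the numbers \<open>step_prob n k r\<close>. They are statements about the chain because, by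
  the Markov property summed over all paths leading to weight \<open>n\<close>, these numbers are the joint law
  of \<open>K\<close> and \<open>R\<close> given weight \<open>n\<close> (\<open>nn_integral_step\<close>).
\<close>

section \<open>The closed form of g\<close>

text \<open>Logarithmic derivative of the reflection formula for the Gamma function.\<close>

lemma Digamma_reflection:
  fixes z :: complex
  assumes "z \<notin> \<int>"
  shows "Digamma z - Digamma (1 - z) = - pi * cos (pi * z) / sin (pi * z)"
proof -
  have z: "z \<notin> \<int>\<^sub>\<le>\<^sub>0" "1 - z \<notin> \<int>\<^sub>\<le>\<^sub>0"
    using assms by (auto dest!: nonpos_Ints_Int)
  have sn: "sin (pi * z) \<noteq> 0"
    using assms by (subst sin_eq_0) (auto simp: Ints_def)
  have "((\<lambda>w. Gamma w * Gamma (1 - w)) has_field_derivative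
          Gamma z * Gamma (1 - z) * (Digamma z - Digamma (1 - z))) (at z)"
    using z by (auto intro!: derivative_eq_intros simp: algebra_simps)
  moreover have "((\<lambda>w. of_real pi / sin (of_real pi * w)) has_field_derivative
          - (pi * (pi * cos (pi * z))) / (sin (pi * z))^2) (at z)"
    using sn by (auto intro!: derivative_eq_intros simp: power2_eq_square)
  ultimately have "Gamma z * Gamma (1 - z) * (Digamma z - Digamma (1 - z))
      = - (pi * (pi * cos (pi * z))) / (sin (pi * z))^2"
    unfolding Gamma_reflection_complex by (rule DERIV_unique)
  hence eq: "of_real pi / sin (of_real pi * z) * (Digamma z - Digamma (1 - z))
      = - (pi * (pi * cos (pi * z))) / (sin (pi * z))^2"
    unfolding Gamma_reflection_complex .
  have "Digamma z - Digamma (1 - z) =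
      sin (pi * z) / pi * (of_real pi / sin (of_real pi * z) * (Digamma z - Digamma (1 - z)))"
    using sn by simp
  also have "\<dots> = - pi * cos (pi * z) / sin (pi * z)"
    unfolding eq using sn by (simp add: power2_eq_square)
  finally show ?thesis .
qed

text \<open>The function \<open>\<Sum>k\<ge>0. (-1)^k / (z + k)\<close>, written through the Digamma function: the even and the
  odd terms are paired, and each half is a Digamma series.\<close>

definition alt_digamma :: "complex \<Rightarrow> complex" where
  "alt_digamma z = (Digamma ((z + 1) / 2) - Digamma (z / 2)) / 2"

lemma alt_digamma_reflection:
  fixes z :: complex
  assumes "z \<notin> \<int>"
  shows "alt_digamma z + alt_digamma (1 - z) = of_real pi / sin (of_real pi * z)"
proof -
  have z1: "z / 2 \<notin> \<int>"
  proof
    assume "z / 2 \<in> \<int>"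
    hence "2 * (z / 2) \<in> \<int>" by (intro Ints_mult) auto
    thus False using assms by simp
  qed
  have z2: "(z + 1) / 2 \<notin> \<int>"
  proof
    assume "(z + 1) / 2 \<in> \<int>"
    then obtain m :: int where "(z + 1) / 2 = of_int m" by (elim Ints_cases)
    hence "z + 1 = of_int (2 * m)" by simp
    hence "z = of_int (2 * m - 1)" by (simp add: eq_diff_eq)
    hence "z \<in> \<int>" by (simp only: Ints_of_int)
    thus False using assms by contradiction
  qed
  define w where "w = pi * (z / 2)"
  have w: "pi * ((z + 1) / 2) = w + of_real pi / 2" "pi * z = 2 * w"
    by (simp_all add: w_def field_simps)
  have sw: "sin w \<noteq> 0" unfolding w_def using z1 by (subst sin_eq_0) (auto simp: Ints_def)
  have "sin (w + of_real pi / 2) \<noteq> 0"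
    unfolding w(1)[symmetric] using z2 by (subst sin_eq_0) (auto simp: Ints_def)
  hence cw: "cos w \<noteq> 0" by (simp add: sin_add)
  have "alt_digamma z + alt_digamma (1 - z) =
    ((Digamma ((z + 1) / 2) - Digamma (1 - (z + 1) / 2)) - (Digamma (z / 2) - Digamma (1 - z / 2))) / 2"
  proof -
    have "(1 - z + 1) / 2 = 1 - z / 2" "(1 - z) / 2 = 1 - (z + 1) / 2"
      by (simp_all add: field_simps)
    moreover have "(A - B) / 2 + (C - D) / 2 = ((A - D) - (B - C)) / 2" for A B C D :: complex
      by (simp add: field_simps)
    ultimately show ?thesis unfolding alt_digamma_def by (simp only:)
  qed
  also have "\<dots> = (- pi * cos (w + of_real pi / 2) / sin (w + of_real pi / 2) + pi * cos w / sin w) / 2"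
    unfolding Digamma_reflection[OF z1] Digamma_reflection[OF z2] w(1) w_def[symmetric] by simp
  also have "\<dots> = (pi * (sin w / cos w) + pi * (cos w / sin w)) / 2"
    by (simp add: sin_add cos_add)
  also have "\<dots> = pi * ((sin w)^2 + (cos w)^2) / (2 * sin w * cos w)"
    using sw cw by (simp add: field_simps power2_eq_square del: sin_cos_squared_add sin_cos_squared_add2 sin_cos_squared_add3)
  also have "\<dots> = pi / sin (pi * z)"
    unfolding w(2) sin_double by simp
  finally show ?thesis .
qed

lemma alternating_sum_tendsto:
  fixes z :: complex
  assumes "z \<notin> \<int>"
  shows "(\<lambda>m. \<Sum>k<2*m. (-1)^k / (z + of_nat k)) \<longlonglongrightarrow> alt_digamma z"
proof -
  have z1: "z / 2 \<noteq> 0" "(z + 1) / 2 \<noteq> 0" using assms by (auto simp: add_eq_0_iff2)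
  have eq: "(\<Sum>k<2*m. (-1)^k / (z + of_nat k)) =
      ((of_real (ln (real m)) - (\<Sum>n<m. inverse ((z + 1) / 2 + of_nat n)))
       - (of_real (ln (real m)) - (\<Sum>n<m. inverse (z / 2 + of_nat n)))) / 2" (is "?l m = ?r m") for m
  proof (induction m)
    case (Suc m)
    have "?l (Suc m) = ?l m + (1 / (z + of_nat (2 * m)) - 1 / (z + of_nat (Suc (2 * m))))"
      by simp
    also have "z + of_nat (2 * m) = 2 * (z / 2 + of_nat m)"
      by (simp add: ring_distribs)
    also have "z + of_nat (Suc (2 * m)) = 2 * ((z + 1) / 2 + of_nat m)"
      by (simp add: ring_distribs add_divide_distrib)
    finally show ?case using Suc.IH by (simp add: field_simps)
  qed simp
  show ?thesis unfolding eq alt_digamma_def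
    by (rule tendsto_divide tendsto_diff Digamma_LIMSEQ z1 tendsto_const zero_neq_numeral[symmetric])+
qed

lemma Im_inverse_shift:
  "Im (1 / (z + of_real x)) = - Im z / ((x + Re z)^2 + (Im z)^2)"
  by (simp add: Im_divide algebra_simps)

text \<open>The alternating series itself converges only conditionally. Its imaginary part converges
  absolutely, so the limit along even partial sums is the unordered sum.\<close>

lemma has_sum_alternating_Im_nat:
  fixes z :: complex
  assumes "Im z \<noteq> 0"
  shows "((\<lambda>k::nat. (-1)^k * Im (1 / (z + of_nat k))) has_sum Im (alt_digamma z)) UNIV"
proof -
  let ?f = "\<lambda>k::nat. (-1)^k * Im (1 / (z + of_nat k))"
  have zi: "z \<notin> \<int>" using assms by (auto simp: Ints_def)
  have f: "norm (?f k) = \<bar>Im z\<bar> / ((real k + Re z)^2 + (Im z)^2)" for k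
    using Im_inverse_shift[of z "real k"] by (simp add: abs_mult)
  have "(\<lambda>k. norm (?f k)) \<in> O(\<lambda>k. 1 / real k ^ 2)"
    unfolding f by real_asymp
  hence s: "summable (\<lambda>k. norm (?f k))"
    by (rule summable_comparison_test_bigo[rotated]) (use inverse_power_summable[of 2] in \<open>simp add: field_simps\<close>)
  hence "?f summable_on UNIV" by (rule norm_summable_imp_summable_on)
  then obtain S where S: "(?f has_sum S) UNIV" by (auto simp: summable_on_def)
  hence "(\<lambda>m. sum ?f {..<m}) \<longlonglongrightarrow> S" using has_sum_imp_sums sums_def by blast
  hence "(\<lambda>m. sum ?f {..<2*m}) \<longlonglongrightarrow> S"
    by (rule filterlim_compose) (auto intro!: filterlim_subseq simp: strict_mono_def)
  moreover have "(\<lambda>m. Im (\<Sum>k<2*m. (-1)^k / (z + of_nat k))) \<longlonglongrightarrow> Im (alt_digamma z)"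
    by (intro tendsto_intros alternating_sum_tendsto zi)
  moreover have "Im ((-1)^k / (z + of_nat k)) = ?f k" for k
    by (cases "even k") auto
  ultimately have "S = Im (alt_digamma z)" by (simp add: LIMSEQ_unique)
  thus ?thesis using S by simp
qed

text \<open>Partial fraction expansion of the cosecant, in imaginary parts. The negative indices
  \<open>k = -1 - l\<close> contribute the same series at \<open>1 - z\<close>, and the reflection formula adds up the two halves.\<close>

lemma has_sum_alternating_Im_int:
  fixes z :: complex
  assumes "Im z \<noteq> 0"
  shows "((\<lambda>k::int. (-1) powi k * Im (1 / (z + of_int k))) has_sum Im (pi / sin (pi * z))) UNIV"
proof -
  let ?f = "\<lambda>k::int. (-1) powi k * Im (1 / (z + of_int k))"
  have zi: "z \<notin> \<int>" using assms by (auto simp: Ints_def)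
  have "((?f \<circ> int) has_sum Im (alt_digamma z)) UNIV"
    using has_sum_alternating_Im_nat[OF assms] by (simp add: o_def)
  hence 1: "(?f has_sum Im (alt_digamma z)) (range int)"
    by (subst has_sum_reindex) auto
  have "?f (- 1 - int l) = (-1)^l * Im (1 / ((1 - z) + of_nat l))" for l
  proof -
    have "z + of_int (- 1 - int l) = - ((1 - z) + of_nat l)" by simp
    hence "Im (1 / (z + of_int (- 1 - int l))) = - Im (1 / ((1 - z) + of_nat l))"
      by (metis minus_divide_right uminus_complex.sel(2))
    moreover have "(-1::real) powi (- 1 - int l) = - ((-1) ^ l)"
      by (simp add: power_int_def nat_add_distrib flip: power_inverse)
    ultimately show ?thesis by simp
  qed
  hence "((?f \<circ> (\<lambda>l. - 1 - int l)) has_sum Im (alt_digamma (1 - z))) UNIV"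
    using has_sum_alternating_Im_nat[of "1 - z"] assms by (simp add: o_def)
  hence 2: "(?f has_sum Im (alt_digamma (1 - z))) (range (\<lambda>l. - 1 - int l))"
    by (subst has_sum_reindex) (auto simp: inj_on_def)
  have u: "range int \<union> range (\<lambda>l. - 1 - int l) = UNIV"
  proof (intro equalityI subsetI)
    fix x :: int show "x \<in> range int \<union> range (\<lambda>l. - 1 - int l)"
    proof (cases "x \<ge> 0")
      case True thus ?thesis by (metis UnI1 nat_0_le rangeI)
    next
      case False hence "x = - 1 - int (nat (-1 - x))" by simp
      thus ?thesis by blast
    qed
  qed auto
  have "(?f has_sum (Im (alt_digamma z) + Im (alt_digamma (1 - z)))) (range int \<union> range (\<lambda>l. - 1 - int l))"
    by (intro has_sum_Un_disjoint 1 2) auto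
  thus ?thesis unfolding u using alt_digamma_reflection[OF zi] by (metis plus_complex.sel(2))
qed

lemma g_closed_form:
  assumes "n \<ge> 1"
  defines "s \<equiv> pi * sqrt (24 * real n - 1) / 6"
  shows "g n = 4 * sqrt 3 * pi^2 * real n / 3 * (sinh s / (s * (2 * cosh (2 * s) - 1)))"
proof -
  define b where "b = sqrt (24 * real n - 1) / 6"
  have b: "b > 0" using assms by (simp add: b_def)
  have b2: "b^2 = (24 * real n - 1) / 36" using assms by (simp add: b_def power_divide)
  have s: "s = pi * b" "s > 0" using b by (simp_all add: s_def b_def)
  \<comment> \<open>completing the square: \<open>n + k(3k+1)/2 = (3/2) |k + z|^2\<close> for this \<open>z\<close>\<close>
  define z where "z = Complex (1/6) b"
  have summand: "(-1) powi k * real n / (real n + real_of_int (k * (3 * k + 1)) / 2)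
      = - (2 * real n / (3 * b)) * ((-1) powi k * Im (1 / (z + of_int k)))" for k :: int
  proof -
    define Q where "Q = real n + real_of_int (k * (3 * k + 1)) / 2"
    have D: "(real_of_int k + 1/6)^2 + b^2 = 2 / 3 * Q" unfolding Q_def
      unfolding b2 by (simp add: power2_eq_square field_simps)
    have "(real_of_int k + 1/6)^2 + b^2 > 0" using b by (simp add: add_nonneg_pos)
    hence "Q > 0" unfolding D by simp
    moreover have "Im (1 / (z + of_int k)) = - b / (2 / 3 * Q)"
      unfolding D[symmetric] using Im_inverse_shift[of z "real_of_int k"] by (simp add: z_def)
    ultimately show ?thesis unfolding Q_def[symmetric] using b by simp
  qed
  have "g n = (\<Sum>\<^sub>\<infinity>k::int. - (2 * real n / (3 * b)) * ((-1) powi k * Im (1 / (z + of_int k))))"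
    unfolding g_def summand using assms by simp
  also have "\<dots> = - (2 * real n / (3 * b)) * Im (pi / sin (pi * z))"
    by (intro infsumI has_sum_cmult_right has_sum_alternating_Im_int) (use b in \<open>simp add: z_def\<close>)
  also have "pi * z = Complex (pi / 6) s"
    by (simp add: z_def s complex_eq_iff)
  also have sin: "sin (Complex (pi / 6) s) = Complex (cosh s / 2) (sqrt 3 / 2 * sinh s)"
    by (simp add: complex_eq_iff Re_sin Im_sin sin_30 cos_30 cosh_def sinh_def field_simps)
  also have "Im (pi / Complex (cosh s / 2) (sqrt 3 / 2 * sinh s))
     = - pi * (sqrt 3 / 2 * sinh s) / ((cosh s / 2)^2 + (sqrt 3 / 2 * sinh s)^2)"
    by (simp add: Im_divide)
  also have "(cosh s / 2)^2 + (sqrt 3 / 2 * sinh s)^2 = (2 * cosh (2 * s) - 1) / 4"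
    by (simp add: cosh_double cosh_square_eq[of s] power_mult_distrib power_divide)
  also have "- (2 * real n / (3 * b)) * (- pi * (sqrt 3 / 2 * sinh s) / ((2 * cosh (2 * s) - 1) / 4))
     = 4 * sqrt 3 * pi^2 * real n / 3 * (sinh s / (s * (2 * cosh (2 * s) - 1)))"
  proof -
    have "- (2 * real n / (3 * b)) * (- pi * (sqrt 3 / 2 * S) / (W / 4))
       = 4 * sqrt 3 * pi^2 * real n / 3 * (S / (s * W))" if "W > 0" for S W
      using b that by (simp add: s field_simps power2_eq_square)
    moreover have "2 * cosh (2 * s) - 1 > 0"
      using cosh_real_ge_1[of "2 * s"] by linarith
    ultimately show ?thesis by blast
  qed
  finally show ?thesis .
qed

section \<open>Asymptotics and bounds of the step probabilities\<close>

text \<open>The closed form says that \<open>g n / n\<close> is a constant times \<open>decay (decay_arg n)\<close>, where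
  \<open>decay s\<close> behaves like \<open>exp (-s) / (2 s)\<close> for large \<open>s\<close> and \<open>decay_arg n\<close> grows like
  \<open>2 pi sqrt n / sqrt 6\<close>.\<close>

definition decay_arg :: "nat \<Rightarrow> real" where
  "decay_arg n = pi * sqrt (24 * real n - 1) / 6"

definition decay :: "real \<Rightarrow> real" where
  "decay s = sinh s / (s * (2 * cosh (2 * s) - 1))"

lemma decay_bounds:
  assumes "s \<ge> 1"
  shows "decay s \<le> exp (- s) / s" "exp (- s) / (4 * s) \<le> decay s" "decay s > 0"
proof -
  define u where "u = exp s"
  have u: "u > 0" "u \<ge> 2" using exp_ge_add_one_self[of s] assms unfolding u_def by (simp, linarith)
  have c: "2 * cosh (2 * s) - 1 = u^2 + inverse (u^2) - 1"
    unfolding cosh_def exp_minus exp_double u_def[symmetric] by (simp add: field_simps)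
  have i: "exp (- s) = inverse u" "sinh s = (u - inverse u) / 2"
    by (simp_all add: u_def exp_minus sinh_def)
  have iu: "inverse u \<le> 1/2" "inverse u > 0" using u by (auto simp: field_simps)
  have "u^2 \<ge> 2^2" using u by (intro power_mono) auto
  hence u2: "u^2 \<ge> 4" by simp
  have iu2: "inverse (u^2) \<le> 1" "inverse (u^2) > 0"
    using u u2 by (auto simp: field_simps)
  have pos: "2 * cosh (2 * s) - 1 > 0" unfolding c using iu2 u2 by linarith
  have "sinh s \<le> inverse u * (2 * cosh (2 * s) - 1)"
  proof -
    have "(u - inverse u) / 2 \<le> u / 2" using iu by simp
    also have "\<dots> = inverse u * (u^2 / 2)" using u by (simp add: power2_eq_square)
    also have "\<dots> \<le> inverse u * (u^2 + inverse (u^2) - 1)"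
      using iu iu2 u2 by (intro mult_left_mono) linarith+
    finally show ?thesis unfolding c i .
  qed
  hence "sinh s / (2 * cosh (2 * s) - 1) / s \<le> inverse u / s"
    using pos assms by (intro divide_right_mono) (simp_all only: pos_divide_le_eq)
  thus "decay s \<le> exp (- s) / s"
    unfolding decay_def i(1) by (simp only: divide_divide_eq_left mult.commute)
  have "inverse u * (2 * cosh (2 * s) - 1) \<le> 4 * sinh s"
  proof -
    have "inverse u * (u^2 + inverse (u^2) - 1) \<le> inverse u * u^2"
      using iu iu2 by (intro mult_left_mono) linarith+
    also have "\<dots> = u" using u by (simp add: power2_eq_square)
    also have "\<dots> \<le> 4 * ((u - inverse u) / 2)"
    proof -
      have "u \<le> 4 * ((u - v) / 2)" if "v \<le> 1/2" for v using that u by simp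
      thus ?thesis using iu(1) .
    qed
    finally show ?thesis unfolding c i .
  qed
  hence "inverse u / 4 / s \<le> sinh s / (2 * cosh (2 * s) - 1) / s"
    using pos assms by (intro divide_right_mono) (simp_all add: pos_le_divide_eq)
  thus *: "exp (- s) / (4 * s) \<le> decay s"
    unfolding decay_def i(1) by (simp only: divide_divide_eq_left mult.commute)
  have "exp (- s) / (4 * s) > 0" using assms by simp
  thus "decay s > 0" using * by linarith
qed

lemma decay_arg_ge_1:
  assumes "n \<ge> 1"
  shows "decay_arg n \<ge> 1"
proof -
  have "sqrt (24 * real n - 1) \<ge> sqrt (2^2)" using assms by (intro real_sqrt_le_mono) simp
  hence "3 * 2 \<le> pi * sqrt (24 * real n - 1)" using pi_gt3 by (intro mult_mono) auto
  thus ?thesis by (simp add: decay_arg_def)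
qed

lemma g_eq_decay: "n \<ge> 1 \<Longrightarrow> g n = 4 * sqrt 3 * pi^2 / 3 * real n * decay (decay_arg n)"
  by (simp add: g_closed_form decay_def decay_arg_def)

lemma step_prob_eq_decay:
  assumes "n \<ge> 1"
  shows "step_prob n k r = real k / real n * (decay (decay_arg (n + k * r)) / decay (decay_arg n))"
proof -
  have "c * M * D / (M * (c * N * E)) = D / E / N" if "c > 0" "M > 0" "N > 0" for c M N D E :: real
    using that by simp
  from this[of "4 * sqrt 3 * pi^2 / 3" "real (n + k * r)" "real n"
      "decay (decay_arg (n + k * r))" "decay (decay_arg n)"]
  show ?thesis using assms decay_bounds(3)[OF decay_arg_ge_1, of n]
    by (simp add: step_prob_def g_eq_decay field_simps del: of_nat_add of_nat_mult)
qed

lemma step_prob_nonneg: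
  assumes "n \<ge> 1"
  shows "step_prob n k r \<ge> 0"
  using decay_bounds(3)[OF decay_arg_ge_1, of n] decay_bounds(3)[OF decay_arg_ge_1, of "n + k * r"] assms
  by (simp add: step_prob_eq_decay)

lemma decay_arg_diff:
  assumes "n \<ge> 1"
  shows "decay_arg (n + d) - decay_arg n
    = 4 * pi * real d / (sqrt (24 * real (n + d) - 1) + sqrt (24 * real n - 1))"
proof -
  define A B where "A = sqrt (24 * real (n + d) - 1)" and "B = sqrt (24 * real n - 1)"
  have "A^2 - B^2 = 24 * real d" "A \<ge> 0" "B > 0" using assms by (auto simp: A_def B_def)
  hence "(A - B) * (A + B) = 24 * real d" "A + B > 0"
    by (simp_all add: power2_eq_square algebra_simps)
  hence "A - B = 24 * real d / (A + B)" by (simp add: field_simps)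
  moreover have "decay_arg (n + d) - decay_arg n = pi / 6 * (A - B)"
    by (simp add: decay_arg_def A_def B_def algebra_simps diff_divide_distrib)
  ultimately show ?thesis unfolding A_def B_def by simp
qed

text \<open>With \<open>d = t sqrt n\<close> the increment of the exponent tends to \<open>pi t / sqrt 6\<close> for fixed \<open>t\<close>, but for \<open>t\<close> much
  larger than \<open>sqrt n\<close> it is only of order \<open>sqrt (t sqrt n)\<close>. The following bound holds for all \<open>n\<close> and \<open>t\<close>.\<close>

lemma decay_arg_diff_ge:
  assumes "n \<ge> 1"
  shows "decay_arg (n + d) - decay_arg n \<ge> sqrt (1 + real d / sqrt (real n)) - 1"
proof -
  define t where "t = real d / sqrt (real n)"
  define w where "w = sqrt (1 + t)"
  have n: "sqrt (real n) \<ge> 1" using assms by simp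
  have t: "t \<ge> 0" by (simp add: t_def)
  have w: "w \<ge> 1" "w^2 = 1 + t" using t by (auto simp: w_def)
  have d: "real d = t * sqrt (real n)" using n by (simp add: t_def)
  have "sqrt (24 * real n - 1) \<le> sqrt (25 * real n)" by simp
  hence B: "sqrt (24 * real n - 1) \<le> 5 * sqrt (real n)" by (simp add: real_sqrt_mult)
  have "t * sqrt (real n) \<le> t * (sqrt (real n) * sqrt (real n))"
    using t mult_left_mono[OF n, of "sqrt (real n)"] by (intro mult_left_mono) simp_all
  hence "real (n + d) \<le> real n * (1 + t)" by (simp add: d algebra_simps)
  hence "sqrt (24 * real (n + d) - 1) \<le> sqrt (25 * (real n * (1 + t)))"
    using assms t by (intro real_sqrt_le_mono) (simp add: algebra_simps)
  hence A: "sqrt (24 * real (n + d) - 1) \<le> 5 * sqrt (real n) * w"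
    by (simp add: real_sqrt_mult w_def)
  have pos: "sqrt (24 * real (n + d) - 1) + sqrt (24 * real n - 1) > 0"
    using assms by (intro add_nonneg_pos) auto
  have "(w - 1) * (w + 1) = t" using w by (simp add: power2_eq_square algebra_simps)
  hence "w - 1 = t / (w + 1)" using w by (simp add: field_simps)
  also have "\<dots> \<le> 12 / 5 * t / (w + 1)" using t w by (intro divide_right_mono) auto
  also have "\<dots> = 12 * real d / (5 * sqrt (real n) * w + 5 * sqrt (real n))"
  proof -
    have "5 * sqrt (real n) * w + 5 * sqrt (real n) = 5 * sqrt (real n) * (w + 1)"
      by (simp add: algebra_simps)
    thus ?thesis unfolding d using n w by simp
  qed
  also have "\<dots> \<le> 4 * pi * real d / (sqrt (24 * real (n + d) - 1) + sqrt (24 * real n - 1))"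
    using A B pos pi_gt3 by (intro frac_le mult_right_mono) auto
  also have "\<dots> = decay_arg (n + d) - decay_arg n" using decay_arg_diff[OF assms] by simp
  finally show ?thesis by (simp add: w_def t_def)
qed

lemma exp_neg_sqrt_le:
  assumes "t \<ge> 0"
  shows "exp (- (sqrt (1 + t) - 1)) \<le> exp 1 * fact (2 * p) / (1 + t) ^ p"
proof -
  define w where "w = sqrt (1 + t)"
  have w: "w > 0" "w ^ (2 * p) = (1 + t) ^ p" using assms by (auto simp: w_def power_mult)
  have "(\<Sum>i\<in>{2*p}. inverse (fact i) * w ^ i) \<le> (\<Sum>i. inverse (fact i) * w ^ i)"
    using w by (intro sum_le_suminf summable_exp) auto
  hence "w ^ (2 * p) / fact (2 * p) \<le> exp w" by (simp add: exp_def field_simps)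
  hence "inverse (exp w) \<le> inverse (w ^ (2 * p) / fact (2 * p))"
    using w(1) by (intro le_imp_inverse_le) (auto intro!: divide_pos_pos)
  hence "exp 1 * inverse (exp w) \<le> exp 1 * inverse (w ^ (2 * p) / fact (2 * p))"
    by (intro mult_left_mono) auto
  moreover have "exp (- (w - 1)) = exp 1 * inverse (exp w)"
    by (simp add: exp_diff divide_inverse)
  ultimately show ?thesis unfolding w_def[symmetric] w(2)[symmetric] by (simp add: divide_inverse mult_ac)
qed

text \<open>The decay beyond scale one of \<open>k r / sqrt n\<close> is faster than any power, uniformly in \<open>n\<close>; this is
  all that is needed for dominated convergence.\<close>

lemma step_prob_le:
  assumes "n \<ge> 1"
  defines "y \<equiv> \<lambda>k. real k / sqrt (real n)"
  shows "sqrt (real n) * step_prob n k r \<le> 4 * exp 1 * fact (2 * p) * (y k / (1 + real r * y k) ^ p)"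
proof -
  define s s' where "s = decay_arg n" and "s' = decay_arg (n + k * r)"
  have t: "real (k * r) / sqrt (real n) = real r * y k" by (simp add: y_def)
  have y: "y k \<ge> 0" by (simp add: y_def)
  have s: "s \<ge> 1" unfolding s_def using decay_arg_ge_1 assms by simp
  have ss: "s' - s \<ge> sqrt (1 + real r * y k) - 1"
    unfolding s_def s'_def using decay_arg_diff_ge[OF assms(1), of "k * r"] by (simp only: t)
  moreover have "sqrt (1 + real r * y k) \<ge> 1" using y by simp
  ultimately have s': "s' \<ge> s" by linarith
  have "decay s' / decay s \<le> (exp (- s') / s') / (exp (- s) / (4 * s))"
    using s s' decay_bounds[of s] decay_bounds[of s'] by (intro frac_le) auto
  also have "\<dots> = 4 * (s / s') * exp (- (s' - s))"
    using s s' by (simp add: exp_diff exp_minus field_simps)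
  also have "\<dots> \<le> 4 * 1 * exp (- (sqrt (1 + real r * y k) - 1))"
    using s s' ss by (intro mult_mono) auto
  also have "\<dots> \<le> 4 * 1 * (exp 1 * fact (2 * p) / (1 + real r * y k) ^ p)"
    using y by (intro mult_left_mono exp_neg_sqrt_le) auto
  finally have "y k * (decay s' / decay s) \<le> y k * (4 * exp 1 * fact (2 * p) / (1 + real r * y k) ^ p)"
    using y by (intro mult_left_mono) (auto simp: mult_ac)
  moreover have "sqrt (real n) * step_prob n k r = y k * (decay s' / decay s)"
  proof -
    have "sqrt (real n) * (real k / real n) = y k"
      unfolding y_def using assms by (simp add: real_div_sqrt field_simps)
    thus ?thesis unfolding step_prob_eq_decay[OF assms(1)] s_def s'_def mult.assoc[symmetric] by simp
  qed
  ultimately show ?thesis by (simp add: mult_ac)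
qed

lemma decay_arg_at_top: "filterlim decay_arg at_top sequentially"
  unfolding decay_arg_def by real_asymp

lemma decay_arg_diff_tendsto:
  fixes k :: "nat \<Rightarrow> nat"
  assumes k: "(\<lambda>n. real (k n) / sqrt (real n)) \<longlonglongrightarrow> x"
  shows "(\<lambda>n. decay_arg (n + k n * r) - decay_arg n) \<longlonglongrightarrow> pi * x * real r / sqrt 6"
proof -
  define y where "y = (\<lambda>n. real (k n) / sqrt (real n))"
  have i: "(\<lambda>n. 1 / sqrt (real n)) \<longlonglongrightarrow> 0" "(\<lambda>n. 1 / real n) \<longlonglongrightarrow> 0" by real_asymp+
  have "(\<lambda>n. 4 * pi * real r * y n / (sqrt (24 + 24 * real r * y n * (1 / sqrt (real n)) - 1 / real n)
        + sqrt (24 - 1 / real n)))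
     \<longlonglongrightarrow> 4 * pi * real r * x / (sqrt (24 + 24 * real r * x * 0 - 0) + sqrt (24 - 0))"
    unfolding y_def by (intro tendsto_intros k i) auto
  moreover have "sqrt 24 = 2 * sqrt (6::real)" using real_sqrt_mult[of 4 6] by simp
  hence "4 * pi * real r * x / (sqrt (24 + 24 * real r * x * 0 - 0) + sqrt (24 - 0)) = pi * x * real r / sqrt 6"
    by simp
  ultimately have lim: "(\<lambda>n. 4 * pi * real r * y n / (sqrt (24 + 24 * real r * y n * (1 / sqrt (real n)) - 1 / real n)
        + sqrt (24 - 1 / real n))) \<longlonglongrightarrow> pi * x * real r / sqrt 6"
    by (simp only:)
  show ?thesis
  proof (rule Lim_transform_eventually[OF lim])
    show "\<forall>\<^sub>F n in sequentially. 4 * pi * real r * y n /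
        (sqrt (24 + 24 * real r * y n * (1 / sqrt (real n)) - 1 / real n) + sqrt (24 - 1 / real n))
        = decay_arg (n + k n * r) - decay_arg n"
      using eventually_ge_at_top[of 1]
    proof eventually_elim
      case (elim n)
      have n: "sqrt (real n) > 0" "sqrt (real n) * sqrt (real n) = real n" using elim by auto
      have k: "real (k n) = y n * sqrt (real n)" using n by (simp add: y_def)
      have "24 * real (n + k n * r) - 1 = real n * (24 + 24 * real r * y n * (1 / sqrt (real n)) - 1 / real n)"
      proof -
        have "real n * (1 / sqrt (real n)) = sqrt (real n)" using n by (simp add: real_div_sqrt)
        hence "24 * real r * y n * (real n * (1 / sqrt (real n))) = 24 * real r * real (k n)"
          unfolding k by (simp only: mult.assoc)
        hence "real n * (24 * real r * y n * (1 / sqrt (real n))) = 24 * real r * real (k n)"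
          by (simp only: mult_ac)
        moreover have "real n * (1 / real n) = 1" using elim by simp
        ultimately show ?thesis unfolding ring_distribs by simp
      qed
      hence A: "sqrt (24 * real (n + k n * r) - 1)
          = sqrt (real n) * sqrt (24 + 24 * real r * y n * (1 / sqrt (real n)) - 1 / real n)"
        by (simp only: real_sqrt_mult)
      have "24 * real n - 1 = real n * (24 - 1 / real n)" using elim by (simp add: algebra_simps)
      hence B: "sqrt (24 * real n - 1) = sqrt (real n) * sqrt (24 - 1 / real n)"
        by (simp only: real_sqrt_mult)
      have "c * (y * q) / (q * A + q * B) = c * y / (A + B)" if "q > 0" for c y q A B :: real
        using that by (simp flip: distrib_left)
      moreover have "4 * pi * real (k n * r) = 4 * pi * real r * (y n * sqrt (real n))"
        by (simp add: k)
      ultimately show ?case unfolding decay_arg_diff[OF elim] A B using n(1) by (simp only:)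
    qed
  qed
qed

lemma decay_exp_tendsto: "((\<lambda>s. s * exp s * decay s) \<longlongrightarrow> 1 / 2) at_top"
  unfolding decay_def sinh_def cosh_def real_scaleR_def by real_asymp

text \<open>The local limit: at scale \<open>k = x sqrt n\<close> the step probabilities are asymptotically
  \<open>x exp (- pi x r / sqrt 6) / sqrt n\<close>.\<close>

lemma step_prob_tendsto:
  fixes k :: "nat \<Rightarrow> nat"
  assumes k: "(\<lambda>n. real (k n) / sqrt (real n)) \<longlonglongrightarrow> x"
  shows "(\<lambda>n. sqrt (real n) * step_prob n (k n) r) \<longlonglongrightarrow> x * exp (- pi * x / sqrt 6) ^ r"
proof -
  define y where "y = (\<lambda>n. real (k n) / sqrt (real n))"
  define s s' where "s = decay_arg" and "s' = (\<lambda>n. decay_arg (n + k n * r))"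
  define \<psi> where "\<psi> = (\<lambda>s. s * exp s * decay s)"
  have d: "(\<lambda>n. s' n - s n) \<longlonglongrightarrow> pi * x * real r / sqrt 6"
    unfolding s_def s'_def by (rule decay_arg_diff_tendsto[OF k])
  have s: "filterlim s at_top sequentially" unfolding s_def by (rule decay_arg_at_top)
  have "filterlim (\<lambda>n. (s' n - s n) + s n) at_top sequentially"
    by (rule filterlim_tendsto_add_at_top[OF d s])
  hence s': "filterlim s' at_top sequentially" by simp
  have "(\<lambda>n. \<psi> (s' n)) \<longlonglongrightarrow> 1 / 2" "(\<lambda>n. \<psi> (s n)) \<longlonglongrightarrow> 1 / 2"
    unfolding \<psi>_def using filterlim_compose[OF decay_exp_tendsto s']
      filterlim_compose[OF decay_exp_tendsto s] by simp_all
  moreover have "(\<lambda>n. (s' n - s n) / s' n) \<longlonglongrightarrow> 0"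
    using d s' by (rule real_tendsto_divide_at_top)
  ultimately have lim: "(\<lambda>n. y n * (\<psi> (s' n) / \<psi> (s n) * (1 - (s' n - s n) / s' n) * exp (- (s' n - s n))))
     \<longlonglongrightarrow> x * ((1/2) / (1/2) * (1 - 0) * exp (- (pi * x * real r / sqrt 6)))"
    unfolding y_def by (intro tendsto_intros k d) auto
  have "exp (- pi * x / sqrt 6) ^ r = exp (- (pi * x * real r / sqrt 6))"
    by (simp add: mult_ac flip: exp_of_nat_mult)
  hence e: "x * exp (- pi * x / sqrt 6) ^ r = x * ((1/2) / (1/2) * (1 - 0) * exp (- (pi * x * real r / sqrt 6)))"
    by simp
  show ?thesis unfolding e
  proof (rule Lim_transform_eventually[OF lim])
    show "\<forall>\<^sub>F n in sequentially. y n * (\<psi> (s' n) / \<psi> (s n) * (1 - (s' n - s n) / s' n) * exp (- (s' n - s n)))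
       = sqrt (real n) * step_prob n (k n) r"
      using eventually_ge_at_top[of 1]
    proof eventually_elim
      case (elim n)
      have "s n \<ge> 1" "s' n \<ge> 1" unfolding s_def s'_def using elim by (auto intro!: decay_arg_ge_1)
      hence "\<psi> (s' n) / \<psi> (s n) * (1 - (s' n - s n) / s' n) * exp (- (s' n - s n)) = decay (s' n) / decay (s n)"
        using decay_bounds(3)[of "s n"] by (simp add: \<psi>_def exp_diff field_simps)
      moreover have "sqrt (real n) * step_prob n (k n) r = y n * (decay (s' n) / decay (s n))"
      proof -
        have "sqrt (real n) * (real (k n) / real n) = y n"
          unfolding y_def using elim by (simp add: real_div_sqrt field_simps)
        thus ?thesis unfolding step_prob_eq_decay[OF elim] s_def s'_def mult.assoc[symmetric] by simp
      qed
      ultimately show ?case by simp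
    qed
  qed
qed

section \<open>Convergence of weighted sums of step probabilities\<close>

text \<open>The terms are bounded by the telescoping differences of \<open>1 / (1 + r y)\<close>.\<close>

lemma suminf_inverse_square_le:
  fixes y :: real
  assumes "y \<ge> 0"
  shows "summable (\<lambda>r. y / (1 + real (Suc r) * y)\<^sup>2)" "(\<Sum>r. y / (1 + real (Suc r) * y)\<^sup>2) \<le> 1"
proof -
  define t where "t = (\<lambda>r::nat. 1 / (1 + real r * y))"
  have le: "y / (1 + real (Suc r) * y)\<^sup>2 \<le> t r - t (Suc r)" for r
  proof -
    define a where "a = 1 + real r * y"
    have a: "a > 0" "1 + real (Suc r) * y = a + y" using assms by (auto simp: a_def add_pos_nonneg algebra_simps)
    have "y / (a + y)\<^sup>2 \<le> y / (a * (a + y))"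
      using a assms by (intro divide_left_mono) (auto simp: power2_eq_square intro!: mult_right_mono)
    also have "\<dots> = 1 / a - 1 / (a + y)" using a assms by (simp add: field_simps)
    finally show ?thesis unfolding t_def a(2) by (simp add: a_def)
  qed
  have part: "(\<Sum>r<n. y / (1 + real (Suc r) * y)\<^sup>2) \<le> 1" for n
  proof -
    have "(\<Sum>r<n. y / (1 + real (Suc r) * y)\<^sup>2) \<le> (\<Sum>r<n. t r - t (Suc r))"
      by (intro sum_mono le)
    also have "\<dots> = t 0 - t n" by (rule sum_lessThan_telescope')
    also have "\<dots> \<le> 1" using assms by (simp add: t_def)
    finally show ?thesis .
  qed
  show s: "summable (\<lambda>r. y / (1 + real (Suc r) * y)\<^sup>2)"
    using part assms by (intro summableI_nonneg_bounded) auto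
  show "(\<Sum>r. y / (1 + real (Suc r) * y)\<^sup>2) \<le> 1"
    using s part by (rule suminf_le_const)
qed

text \<open>A sum over positive integers as the integral of a step function, the form in which dominated
  convergence applies.\<close>

lemma nn_integral_ceiling:
  fixes h :: "nat \<Rightarrow> ennreal" and c :: real
  assumes c: "c > 0"
  shows "(\<integral>\<^sup>+y. h (nat \<lceil>y * c\<rceil>) * indicator {0<..} y \<partial>lborel) = (\<Sum>k. h (Suc k) * ennreal (1 / c))"
proof -
  have eq: "h (nat \<lceil>y * c\<rceil>) * indicator {0<..} y
      = (\<Sum>k. h (Suc k) * indicator {real k / c<..real (Suc k) / c} y)" for y :: real
  proof (cases "y > 0")
    case True
    define m where "m = nat \<lceil>y * c\<rceil> - 1"
    have "y * c > 0" using True c by simp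
    hence "\<lceil>y * c\<rceil> \<ge> 1" by linarith
    hence m: "nat \<lceil>y * c\<rceil> = Suc m" by (simp add: m_def)
    have ind: "y \<in> {real k / c<..real (Suc k) / c} \<longleftrightarrow> k = m" for k
    proof -
      have "y \<in> {real k / c<..real (Suc k) / c} \<longleftrightarrow> real k < y * c \<and> y * c \<le> real (Suc k)"
        using c by (auto simp: field_simps)
      also have "\<dots> \<longleftrightarrow> \<lceil>y * c\<rceil> = int (Suc k)"
        by (subst ceiling_eq_iff) auto
      also have "\<dots> \<longleftrightarrow> k = m" using m \<open>\<lceil>y * c\<rceil> \<ge> 1\<close> by auto
      finally show ?thesis .
    qed
    have "(\<Sum>k. h (Suc k) * indicator {real k / c<..real (Suc k) / c} y)
        = (\<Sum>k\<in>{m}. h (Suc k) * indicator {real k / c<..real (Suc k) / c} y)"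
      by (intro suminf_finite) (auto simp: indicator_def ind simp del: greaterThanAtMost_iff of_nat_Suc)
    also have "\<dots> = h (Suc m)" using ind[of m] by (simp add: indicator_def del: greaterThanAtMost_iff of_nat_Suc)
    finally show ?thesis using True m by simp
  next
    case False
    have "indicator {real k / c<..real (Suc k) / c} y = (0::ennreal)" for k
    proof -
      have "real k / c \<ge> 0" using c by simp
      thus ?thesis using False by (auto simp: indicator_def)
    qed
    thus ?thesis using False by simp
  qed
  have "(\<integral>\<^sup>+y. h (nat \<lceil>y * c\<rceil>) * indicator {0<..} y \<partial>lborel)
      = (\<Sum>k. \<integral>\<^sup>+y. h (Suc k) * indicator {real k / c<..real (Suc k) / c} y \<partial>lborel)"
    unfolding eq by (rule nn_integral_suminf) auto
  also have "\<dots> = (\<Sum>k. h (Suc k) * ennreal (1 / c))"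
  proof (rule suminf_cong)
    fix k
    have "real k / c \<le> real (Suc k) / c" using c by (intro divide_right_mono) auto
    moreover have "real (Suc k) / c - real k / c = 1 / c" by (simp flip: diff_divide_distrib)
    ultimately show "(\<integral>\<^sup>+y. h (Suc k) * indicator {real k / c<..real (Suc k) / c} y \<partial>lborel)
      = h (Suc k) * ennreal (1 / c)"
      by (subst nn_integral_cmult_indicator) (auto simp del: of_nat_Suc)
  qed
  finally show ?thesis .
qed

lemma nat_ceiling_div_tendsto:
  assumes "y > 0"
  shows "(\<lambda>n. real (nat \<lceil>y * sqrt (real n)\<rceil>) / sqrt (real n)) \<longlonglongrightarrow> y"
proof (rule tendsto_sandwich[where f = "\<lambda>_. y" and h = "\<lambda>n. y + 1 / sqrt (real n)"])
  have "(\<lambda>n. 1 / sqrt (real n)) \<longlonglongrightarrow> 0" by real_asymp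
  from tendsto_add[OF tendsto_const[of y] this] show "(\<lambda>n. y + 1 / sqrt (real n)) \<longlonglongrightarrow> y" by simp
  have c: "y * sqrt (real n) \<le> real (nat \<lceil>y * sqrt (real n)\<rceil>)"
       "real (nat \<lceil>y * sqrt (real n)\<rceil>) \<le> y * sqrt (real n) + 1" for n
  proof -
    have "y * sqrt (real n) \<ge> 0" using assms by simp
    hence "real (nat \<lceil>y * sqrt (real n)\<rceil>) = of_int \<lceil>y * sqrt (real n)\<rceil>" by simp
    thus "y * sqrt (real n) \<le> real (nat \<lceil>y * sqrt (real n)\<rceil>)"
       "real (nat \<lceil>y * sqrt (real n)\<rceil>) \<le> y * sqrt (real n) + 1"
      using ceiling_correct[of "y * sqrt (real n)"] by linarith+
  qed
  show "\<forall>\<^sub>F n in sequentially. y \<le> real (nat \<lceil>y * sqrt (real n)\<rceil>) / sqrt (real n)"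
    using eventually_gt_at_top[of 0] by eventually_elim (simp add: c field_simps)
  show "\<forall>\<^sub>F n in sequentially. real (nat \<lceil>y * sqrt (real n)\<rceil>) / sqrt (real n) \<le> y + 1 / sqrt (real n)"
    using eventually_gt_at_top[of 0]
  proof eventually_elim
    case (elim n)
    have "real (nat \<lceil>y * sqrt (real n)\<rceil>) / sqrt (real n) \<le> (y * sqrt (real n) + 1) / sqrt (real n)"
      by (intro divide_right_mono c) auto
    thus ?case using elim by (simp add: add_divide_distrib)
  qed
qed auto

lemma zero_le_mult_cancel: "0 \<le> C * a \<Longrightarrow> 0 < a \<Longrightarrow> 0 \<le> (C::real)"
  by (auto simp: zero_le_mult_iff)

text \<open>With \<open>y = k / sqrt n\<close>, weights of polynomial growth in \<open>r y\<close> are absorbed by the power decay of the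
  step probability. The majorant separates into an integrable factor in \<open>y\<close> and a factor whose sum over \<open>r\<close>
  is at most 1.\<close>

lemma weighted_step_prob_le:
  assumes n: "n \<ge> 1" and r: "r \<ge> 1" and f: "0 \<le> f" "f \<le> C * (1 + real r * (real k / sqrt (real n))) ^ \<nu>"
  defines "y \<equiv> real k / sqrt (real n)"
  defines "D \<equiv> 4 * exp 1 * fact (2 * (\<nu> + 4))"
  shows "f * (sqrt (real n) * step_prob n k r) \<le> C * D / (1 + y)\<^sup>2 * (y / (1 + real r * y)\<^sup>2)"
proof -
  have y: "y \<ge> 0" by (simp add: y_def)
  define b where "b = 1 + real r * y"
  have b: "b \<ge> 1 + y" "b > 0" using y r mult_right_mono[of 1 "real r" y] by (auto simp: b_def)
  have f': "f \<le> C * b ^ \<nu>" using f(2) by (simp add: b_def y_def)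
  have "0 \<le> C * b ^ \<nu>" using f(1) f' by linarith
  hence C: "C \<ge> 0" using zero_less_power[OF b(2), of \<nu>] by (rule zero_le_mult_cancel)
  have D: "D \<ge> 0" by (simp add: D_def)
  have "sqrt (real n) * step_prob n k r \<le> D * (y / b ^ (\<nu> + 4))"
    unfolding D_def y_def b_def by (rule step_prob_le[OF n])
  hence "f * (sqrt (real n) * step_prob n k r) \<le> (C * b ^ \<nu>) * (D * (y / b ^ (\<nu> + 4)))"
    by (rule mult_mono[OF f']) (use f(1) step_prob_nonneg[OF n] C b in auto)
  also have "\<dots> = C * D * (1 / b\<^sup>2) * (y / b\<^sup>2)"
    using b by (simp add: power_add field_simps flip: power_numeral_reduce)
  also have "\<dots> \<le> C * D * (1 / (1 + y)\<^sup>2) * (y / b\<^sup>2)"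
    using b y C D by (intro mult_right_mono mult_left_mono divide_left_mono power_mono) auto
  finally show ?thesis by (simp add: b_def)
qed

lemma summable_step_prob:
  assumes "n \<ge> 1" "k \<ge> 1"
  shows "summable (\<lambda>r. step_prob n k (Suc r))"
proof -
  let ?y = "real k / sqrt (real n)"
  have le: "1 * (sqrt (real n) * step_prob n k (Suc r))
     \<le> 1 * (4 * exp 1 * fact (2 * (0 + 4))) / (1 + ?y)\<^sup>2 * (?y / (1 + real (Suc r) * ?y)\<^sup>2)" for r
    by (intro weighted_step_prob_le assms) auto
  have "summable (\<lambda>r. sqrt (real n) * step_prob n k (Suc r))"
  proof (rule summable_comparison_test'[where N = 0])
    show "summable (\<lambda>r. 1 * (4 * exp 1 * fact (2 * (0 + 4))) / (1 + ?y)\<^sup>2 *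
        (?y / (1 + real (Suc r) * ?y)\<^sup>2))"
      by (intro summable_mult suminf_inverse_square_le) simp
    show "norm (sqrt (real n) * step_prob n k (Suc r))
       \<le> 1 * (4 * exp 1 * fact (2 * (0 + 4))) / (1 + ?y)\<^sup>2 * (?y / (1 + real (Suc r) * ?y)\<^sup>2)" for r
      using le[of r] step_prob_nonneg[OF assms(1), of k "Suc r"] by (simp only: real_norm_def abs_of_nonneg abs_mult mult_1 real_sqrt_ge_zero of_nat_0_le_iff)
  qed
  from summable_mult[OF this, of "1 / sqrt (real n)"] show ?thesis using assms by simp
qed

text \<open>Passage to the limit in the sum over \<open>r\<close> along part sizes of order \<open>sqrt n\<close>, by Tannery's theorem.\<close>

lemma weighted_row_sum_tendsto:
  fixes f :: "nat \<Rightarrow> nat \<Rightarrow> real" and k :: "nat \<Rightarrow> nat"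
  assumes x: "x > 0" and k: "\<And>n. n \<ge> 1 \<Longrightarrow> k n \<ge> 1" and klim: "(\<lambda>n. real (k n) / sqrt (real n)) \<longlonglongrightarrow> x"
    and nonneg: "\<And>n r. f n r \<ge> 0"
    and bound: "\<And>n r. n \<ge> 1 \<Longrightarrow> r \<ge> 1 \<Longrightarrow> f n r \<le> C * (1 + real r * (real (k n) / sqrt (real n))) ^ \<nu>"
    and lim: "\<And>r. r \<ge> 1 \<Longrightarrow> (\<lambda>n. f n r) \<longlonglongrightarrow> l r"
  shows "(\<lambda>n. \<Sum>r. f n (Suc r) * (sqrt (real n) * step_prob n (k n) (Suc r)))
      \<longlonglongrightarrow> (\<Sum>r. l (Suc r) * (x * exp (- pi * x / sqrt 6) ^ Suc r))"
proof -
  define D where "D = C * (4 * exp 1 * fact (2 * (\<nu> + 4)))"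
  define y where "y = (\<lambda>n. real (k n) / sqrt (real n))"
  define a where "a = (\<lambda>r n. f n (Suc r) * (sqrt (real n) * step_prob n (k n) (Suc r)))"
  define M where "M = (\<lambda>r. D * (2 / x / (real (Suc r))\<^sup>2))"
  have "0 \<le> C * (1 + real 1 * (real (k 1) / sqrt (real 1))) ^ \<nu>"
    by (rule order_trans[OF nonneg bound]) auto
  hence C: "C \<ge> 0" by (rule zero_le_mult_cancel) (simp add: add_pos_nonneg)
  hence D: "D \<ge> 0" by (simp add: D_def)
  \<comment> \<open>away from \<open>y = 0\<close> the rows have the common summable majorant \<open>M\<close>\<close>
  have "\<forall>\<^sub>F n in sequentially. y n > x / 2"
    using klim x unfolding y_def by (intro order_tendstoD) auto
  then obtain N where N: "\<And>n. n \<ge> N \<Longrightarrow> y n > x / 2" by (auto simp: eventually_sequentially)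
  have "norm (a r n) \<le> M r" if n: "n \<ge> max 1 N" for r n
  proof -
    have yn: "y n > x / 2" using N n by simp
    have "a r n \<le> D / (1 + y n)\<^sup>2 * (y n / (1 + real (Suc r) * y n)\<^sup>2)"
      unfolding a_def D_def y_def using n by (intro weighted_step_prob_le nonneg bound) auto
    also have "\<dots> \<le> D / 1 * (2 / x / (real (Suc r))\<^sup>2)"
    proof (intro mult_mono)
      show "D / (1 + y n)\<^sup>2 \<le> D / 1"
        using D yn x by (intro divide_left_mono) (auto intro!: one_le_power)
      have "y n / (1 + real (Suc r) * y n)\<^sup>2 \<le> y n / (real (Suc r) * y n)\<^sup>2"
        using yn x by (intro divide_left_mono power_mono mult_pos_pos zero_less_power add_pos_pos) auto
      also have "\<dots> = 1 / y n / (real (Suc r))\<^sup>2"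
        using yn x by (simp add: power2_eq_square)
      also have "\<dots> \<le> 1 / (x / 2) / (real (Suc r))\<^sup>2"
        using yn x by (intro divide_right_mono divide_left_mono) auto
      finally show "y n / (1 + real (Suc r) * y n)\<^sup>2 \<le> 2 / x / (real (Suc r))\<^sup>2" by simp
    qed (use D yn x in auto)
    finally have "a r n \<le> M r" by (simp add: M_def)
    moreover have "a r n \<ge> 0" unfolding a_def using nonneg step_prob_nonneg n by simp
    ultimately show ?thesis by simp
  qed
  hence ev: "\<forall>\<^sub>F (r, n) in at_top \<times>\<^sub>F sequentially. norm (a r n) \<le> M r"
    unfolding eventually_prod_sequentially by (intro exI[of _ "max 1 N"]) auto
  have "summable (\<lambda>r. inverse (real (Suc r) ^ 2))"
    by (subst summable_Suc_iff) (rule inverse_power_summable, simp)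
  hence summ: "summable M" unfolding M_def divide_inverse by (intro summable_mult) (simp only: power2_eq_square)
  have "(\<lambda>n. a r n) \<longlonglongrightarrow> l (Suc r) * (x * exp (- pi * x / sqrt 6) ^ Suc r)" for r
    unfolding a_def by (intro tendsto_mult[of "\<lambda>n. f n (Suc r)"] lim step_prob_tendsto klim) simp
  from tannerys_theorem[OF this ev summ] show ?thesis unfolding a_def by simp
qed

text \<open>The convergence principle behind all the limits of moments and distribution functions: a weight
  \<open>F\<close> of polynomial growth in \<open>k r / sqrt n\<close>, converging at scale \<open>k = y sqrt n\<close>, has a limiting
  expectation, computed with the limit law of \<open>(k / sqrt n, r)\<close>, whose density is
  \<open>y exp (- pi y r / sqrt 6)\<close>. The rescaled sums over \<open>r\<close> are functions of \<open>y\<close> dominated by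
  a multiple of \<open>1 / (1 + y)^2\<close>.\<close>

lemma step_sum_tendsto:
  fixes F :: "nat \<Rightarrow> nat \<Rightarrow> nat \<Rightarrow> real" and L :: "real \<Rightarrow> nat \<Rightarrow> real"
  assumes nonneg: "\<And>n k r. F n k r \<ge> 0"
    and bound: "\<And>n k r. n \<ge> 1 \<Longrightarrow> k \<ge> 1 \<Longrightarrow> r \<ge> 1 \<Longrightarrow>
      F n k r \<le> C * (1 + real r * (real k / sqrt (real n))) ^ \<nu>"
    and lim: "AE y in lborel. y > 0 \<longrightarrow> (\<forall>r\<ge>1. (\<lambda>n. F n (nat \<lceil>y * sqrt (real n)\<rceil>) r) \<longlonglongrightarrow> L y r)"
    and meas [measurable]: "\<And>r. (\<lambda>y. L y r) \<in> borel_measurable borel"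
  defines "S \<equiv> \<lambda>n. \<Sum>k. \<Sum>r. ennreal (F n (Suc k) (Suc r) * step_prob n (Suc k) (Suc r))"
  shows "S \<longlonglongrightarrow> (\<integral>\<^sup>+y. ennreal (\<Sum>r. L y (Suc r) * (y * exp (- pi * y / sqrt 6) ^ Suc r))
            * indicator {0<..} y \<partial>lborel)"
    and "\<And>n. n \<ge> 1 \<Longrightarrow> S n < \<infinity>"
    and "(\<integral>\<^sup>+y. ennreal (\<Sum>r. L y (Suc r) * (y * exp (- pi * y / sqrt 6) ^ Suc r))
            * indicator {0<..} y \<partial>lborel) < \<infinity>"
proof -
  define D where "D = C * (4 * exp 1 * fact (2 * (\<nu> + 4)))"
  define G where "G = (\<lambda>n k. \<Sum>r. F n k (Suc r) * (sqrt (real n) * step_prob n k (Suc r)))"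
  define w where "w = (\<lambda>y::real. ennreal (D / (1 + y)\<^sup>2) * indicator {0..} y)"
  have "0 \<le> C * (1 + real 1 * (real 1 / sqrt (real 1))) ^ \<nu>"
    by (rule order_trans[OF nonneg bound]) auto
  hence C: "C \<ge> 0" by (rule zero_le_mult_cancel) simp
  hence D: "D \<ge> 0" by (simp add: D_def)
  have term_le: "F n k (Suc r) * (sqrt (real n) * step_prob n k (Suc r))
      \<le> D / (1 + real k / sqrt (real n))\<^sup>2 *
         (real k / sqrt (real n) / (1 + real (Suc r) * (real k / sqrt (real n)))\<^sup>2)"
    if "n \<ge> 1" "k \<ge> 1" for n k r
    unfolding D_def using that by (intro weighted_step_prob_le nonneg bound) auto
  have term_nonneg: "F n k r * (sqrt (real n) * step_prob n k r) \<ge> 0" if "n \<ge> 1" for n k r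
    using nonneg step_prob_nonneg[OF that] by simp
  have summ: "summable (\<lambda>r. F n k (Suc r) * (sqrt (real n) * step_prob n k (Suc r)))"
    if "n \<ge> 1" "k \<ge> 1" for n k
  proof (rule summable_comparison_test'[where N = 0])
    show "summable (\<lambda>r. D / (1 + real k / sqrt (real n))\<^sup>2 *
         (real k / sqrt (real n) / (1 + real (Suc r) * (real k / sqrt (real n)))\<^sup>2))"
      by (intro summable_mult suminf_inverse_square_le) simp
  qed (use term_le[OF that] term_nonneg[OF that(1)] in \<open>simp only: real_norm_def abs_of_nonneg\<close>)
  have G_nonneg: "G n k \<ge> 0" if "n \<ge> 1" "k \<ge> 1" for n k
    unfolding G_def using summ[OF that] term_nonneg[OF that(1)] by (intro suminf_nonneg) auto
  have G_le: "G n k \<le> D / (1 + real k / sqrt (real n))\<^sup>2" if "n \<ge> 1" "k \<ge> 1" for n k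
  proof -
    let ?y = "real k / sqrt (real n)"
    have y: "?y \<ge> 0" by simp
    have "G n k \<le> (\<Sum>r. D / (1 + ?y)\<^sup>2 * (?y / (1 + real (Suc r) * ?y)\<^sup>2))"
      unfolding G_def by (intro suminf_le summ term_le that summable_mult suminf_inverse_square_le y)
    also have "\<dots> = D / (1 + ?y)\<^sup>2 * (\<Sum>r. ?y / (1 + real (Suc r) * ?y)\<^sup>2)"
      by (intro suminf_mult suminf_inverse_square_le y)
    also have "\<dots> \<le> D / (1 + ?y)\<^sup>2 * 1"
      using D by (intro mult_left_mono suminf_inverse_square_le y) auto
    finally show ?thesis by simp
  qed
  have S_eq: "S n = (\<integral>\<^sup>+y. ennreal (G n (nat \<lceil>y * sqrt (real n)\<rceil>)) * indicator {0<..} y \<partial>lborel)"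
    if n: "n \<ge> 1" for n
  proof -
    have "(\<Sum>r. ennreal (F n (Suc k) (Suc r) * step_prob n (Suc k) (Suc r)))
        = ennreal (G n (Suc k)) * ennreal (1 / sqrt (real n))" for k
    proof -
      have "F n (Suc k) (Suc r) * step_prob n (Suc k) (Suc r) =
         F n (Suc k) (Suc r) * (sqrt (real n) * step_prob n (Suc k) (Suc r)) * (1 / sqrt (real n))" for r
        using n by simp
      hence "ennreal (F n (Suc k) (Suc r) * step_prob n (Suc k) (Suc r)) =
         ennreal (F n (Suc k) (Suc r) * (sqrt (real n) * step_prob n (Suc k) (Suc r))) * ennreal (1 / sqrt (real n))" for r
        using term_nonneg[OF n, of "Suc k" "Suc r"] by (metis ennreal_mult')
      hence "(\<Sum>r. ennreal (F n (Suc k) (Suc r) * step_prob n (Suc k) (Suc r))) =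
         (\<Sum>r. ennreal (F n (Suc k) (Suc r) * (sqrt (real n) * step_prob n (Suc k) (Suc r))) * ennreal (1 / sqrt (real n)))"
        by (simp only:)
      also have "\<dots> = ennreal (G n (Suc k)) * ennreal (1 / sqrt (real n))"
        unfolding G_def using term_nonneg[OF n] summ[OF n, of "Suc k"]
        by (subst ennreal_suminf_multc) (simp add: suminf_ennreal2)
      finally show ?thesis .
    qed
    thus ?thesis unfolding S_def using n by (subst nn_integral_ceiling) auto
  qed
  have w_int: "(\<integral>\<^sup>+y. w y \<partial>lborel) < \<infinity>"
  proof -
    have "(\<integral>\<^sup>+y. w y \<partial>lborel) = ennreal (0 - (- D / (1 + 0)))"
      unfolding w_def
    proof (rule nn_integral_FTC_atLeast)
      show "((\<lambda>y. - D / (1 + y)) has_real_derivative D / (1 + y)\<^sup>2) (at y)" if "0 \<le> y" for y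
        using that by (auto intro!: derivative_eq_intros simp: power2_eq_square)
      show "((\<lambda>y. - D / (1 + y)) \<longlongrightarrow> 0) at_top" by real_asymp
    qed (use D in auto)
    thus ?thesis by simp
  qed
  have le_w: "ennreal (G n (nat \<lceil>y * sqrt (real n)\<rceil>)) * indicator {0<..} y \<le> w y" if n: "n \<ge> 1" for n y
  proof (cases "y > 0")
    case True
    define k where "k = nat \<lceil>y * sqrt (real n)\<rceil>"
    have pos: "y * sqrt (real n) > 0" using True n by simp
    hence k: "k \<ge> 1" "y * sqrt (real n) \<le> real k" unfolding k_def by linarith+
    hence "y \<le> real k / sqrt (real n)" using n by (simp add: field_simps)
    hence "D / (1 + real k / sqrt (real n))\<^sup>2 \<le> D / (1 + y)\<^sup>2"
      using True D by (intro divide_left_mono power_mono) auto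
    hence "G n k \<le> D / (1 + y)\<^sup>2" using G_le[OF n k(1)] by linarith
    thus ?thesis using True by (simp add: w_def k_def ennreal_leI)
  qed simp
  have S_le: "S n \<le> (\<integral>\<^sup>+y. w y \<partial>lborel)" if n: "n \<ge> 1" for n
    unfolding S_eq[OF n] by (intro nn_integral_mono le_w n)
  show "S n < \<infinity>" if "n \<ge> 1" for n
    using S_le[OF that] w_int by (rule le_less_trans)
  let ?Lim = "\<lambda>y. ennreal (\<Sum>r. L y (Suc r) * (y * exp (- pi * y / sqrt 6) ^ Suc r)) * indicator {0<..} y"
  have S_Suc: "S (Suc i) = (\<integral>\<^sup>+y. ennreal (G (Suc i) (nat \<lceil>y * sqrt (real (Suc i))\<rceil>)) * indicator {0<..} y \<partial>lborel)" for i
    by (rule S_eq) simp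
  have "(\<lambda>i. S (Suc i)) \<longlonglongrightarrow> (\<integral>\<^sup>+y. ?Lim y \<partial>lborel)"
    unfolding S_Suc
  proof (rule nn_integral_dominated_convergence[where w = w])
    show "AE y in lborel. (\<lambda>i. ennreal (G (Suc i) (nat \<lceil>y * sqrt (real (Suc i))\<rceil>)) * indicator {0<..} y)
        \<longlonglongrightarrow> ?Lim y"
      using lim
    proof eventually_elim
      case (elim y)
      show ?case
      proof (cases "y > 0")
        case True
        define k where "k = (\<lambda>n. nat \<lceil>y * sqrt (real n)\<rceil>)"
        have k1: "k n \<ge> 1" "y \<le> real (k n) / sqrt (real n)" if "n \<ge> 1" for n
        proof -
          have "y * sqrt (real n) > 0" using True that by simp
          hence k: "k n \<ge> 1" "y * sqrt (real n) \<le> real (k n)" unfolding k_def by linarith+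
          show "k n \<ge> 1" by fact
          show "y \<le> real (k n) / sqrt (real n)" using that k(2) by (simp add: field_simps)
        qed
        have klim: "(\<lambda>n. real (k n) / sqrt (real n)) \<longlonglongrightarrow> y"
          unfolding k_def by (rule nat_ceiling_div_tendsto[OF True])
        have "(\<lambda>n. G n (k n)) \<longlonglongrightarrow> (\<Sum>r. L y (Suc r) * (y * exp (- pi * y / sqrt 6) ^ Suc r))"
          unfolding G_def
        proof (rule weighted_row_sum_tendsto[OF True k1(1) klim])
          show "F n (k n) r \<le> C * (1 + real r * (real (k n) / sqrt (real n))) ^ \<nu>"
            if "n \<ge> 1" "r \<ge> 1" for n r using that k1(1) by (intro bound) auto
          show "(\<lambda>n. F n (k n) r) \<longlonglongrightarrow> L y r" if "r \<ge> 1" for r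
            using elim True that by (simp add: k_def)
        qed (use nonneg in auto)
        hence "(\<lambda>n. ennreal (G n (k n))) \<longlonglongrightarrow> ennreal (\<Sum>r. L y (Suc r) * (y * exp (- pi * y / sqrt 6) ^ Suc r))"
          by (rule tendsto_ennrealI)
        hence "(\<lambda>i. ennreal (G (Suc i) (k (Suc i))))
            \<longlonglongrightarrow> ennreal (\<Sum>r. L y (Suc r) * (y * exp (- pi * y / sqrt 6) ^ Suc r))"
          by (rule LIMSEQ_Suc)
        thus ?thesis using True by (simp add: k_def del: of_nat_Suc power_Suc)
      qed simp
    qed
    show "AE y in lborel. ennreal (G (Suc i) (nat \<lceil>y * sqrt (real (Suc i))\<rceil>)) * indicator {0<..} y \<le> w y" for i
      by (intro AE_I2 le_w) simp
  qed (use w_int in \<open>auto simp: w_def\<close>)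
  thus *: "S \<longlonglongrightarrow> (\<integral>\<^sup>+y. ?Lim y \<partial>lborel)" by (simp only: filterlim_sequentially_Suc)
  have "(\<integral>\<^sup>+y. ?Lim y \<partial>lborel) \<le> (\<integral>\<^sup>+y. w y \<partial>lborel)"
    using * by (rule LIMSEQ_le_const2) (use S_le in blast)
  thus "(\<integral>\<^sup>+y. ?Lim y \<partial>lborel) < \<infinity>" using w_int by (rule le_less_trans)
qed

section \<open>The law of a step given the weight\<close>

lemma replicate_mset_eq_iff:
  assumes "r \<ge> 1"
  shows "replicate_mset r k = replicate_mset r' k' \<longleftrightarrow> r = r' \<and> k = k'"
proof
  assume eq: "replicate_mset r k = replicate_mset r' k'"
  have "r = r'" using arg_cong[OF eq, of size] by simp
  moreover have "k = k'"
    using arg_cong[OF eq, of set_mset] assms by (auto split: if_splits)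
  ultimately show "r = r' \<and> k = k'" by simp
qed auto

lemma K_R_eqI:
  assumes "adds_parts (\<Lambda> j \<omega>) (\<Lambda> (Suc j) \<omega>) k r"
  shows "K \<Lambda> j \<omega> = k" "R \<Lambda> j \<omega> = r"
proof -
  have uniq: "k' = k \<and> r' = r" if "adds_parts (\<Lambda> j \<omega>) (\<Lambda> (Suc j) \<omega>) k' r'" for k' r'
    using that assms replicate_mset_eq_iff[of r' k' r k] by (auto simp: adds_parts_def)
  show "K \<Lambda> j \<omega> = k" unfolding K_def using assms uniq by (intro the_equality) blast+
  show "R \<Lambda> j \<omega> = r" unfolding R_def using assms uniq by (intro the_equality) blast+
qed

lemma countable_nat_multisets: "countable (UNIV :: nat multiset set)"
  by (metis countableI_type countable_image surj_mset)

context partition_chain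
begin

lemma measurable_state [measurable]: "\<Lambda> i \<in> measurable M (count_space UNIV)"
  using measurable_compose[OF measurable_chain, of "\<lambda>x. x" "count_space UNIV"] by simp

lemma measurable_two_states: "(\<lambda>\<omega>. h (\<Lambda> i \<omega>) (\<Lambda> i' \<omega>)) \<in> measurable M (count_space UNIV)"
proof -
  have "(\<lambda>\<omega>. (\<Lambda> i \<omega>, \<Lambda> i' \<omega>)) \<in> measurable M (count_space UNIV \<Otimes>\<^sub>M count_space UNIV)"
    by measurable
  hence "(\<lambda>\<omega>. (\<Lambda> i \<omega>, \<Lambda> i' \<omega>)) \<in> measurable M (count_space UNIV)"
    by (simp add: pair_measure_countable countable_nat_multisets)
  from measurable_compose[OF this, of "\<lambda>(a, b). h a b" "count_space UNIV"] show ?thesis by simp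
qed

lemma measurable_K [measurable]: "K \<Lambda> j \<in> measurable M (count_space UNIV)"
  using measurable_two_states[of "\<lambda>\<mu> \<nu>. THE k. \<exists>r. adds_parts \<mu> \<nu> k r" j "Suc j"]
  by (simp add: K_def[abs_def])

lemma measurable_R [measurable]: "R \<Lambda> j \<in> measurable M (count_space UNIV)"
  using measurable_two_states[of "\<lambda>\<mu> \<nu>. THE r. \<exists>k. adds_parts \<mu> \<nu> k r" j "Suc j"]
  by (simp add: R_def[abs_def])

lemma sets_state_eq: "{\<omega> \<in> space M. P (\<Lambda> i \<omega>)} \<in> sets M"
  using measurable_sets[OF measurable_state, of "Collect P" i] by (simp add: vimage_def Int_def conj_commute)

text \<open>The transition law of the chain with the conditioning multiplied out; it then also covers
  paths of probability zero.\<close>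

lemma emeasure_step_path:
  assumes n: "sum_mset (x j) = n" "n \<ge> 1" and kr: "k \<ge> 1" "r \<ge> 1"
  shows "emeasure M {\<omega> \<in> space M. (\<forall>i\<le>j. \<Lambda> i \<omega> = x i) \<and> \<Lambda> (Suc j) \<omega> = x j + replicate_mset r k}
    = ennreal (step_prob n k r) * emeasure M {\<omega> \<in> space M. \<forall>i\<le>j. \<Lambda> i \<omega> = x i}"
    (is "emeasure M ?B = _ * emeasure M ?A")
proof (cases "\<P>(\<omega> in M. \<forall>i\<le>j. \<Lambda> i \<omega> = x i) > 0")
  case True
  have "prob ?B / prob ?A = step_prob n k r"
    using transition[OF True kr] n by (simp add: cond_prob_def conj_commute)
  hence "prob ?B = step_prob n k r * prob ?A" using True by (simp add: field_simps)
  thus ?thesis using step_prob_nonneg[OF n(2)] by (simp add: emeasure_eq_measure ennreal_mult)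
next
  case False
  hence "prob ?A = 0" by (simp add: zero_less_measure_iff)
  moreover have "prob ?B \<le> prob ?A" by (intro finite_measure_mono) auto
  ultimately have "prob ?B = 0" by (simp add: measure_le_0_iff)
  with \<open>prob ?A = 0\<close> show ?thesis by (simp add: emeasure_eq_measure)
qed

text \<open>The transition probabilities depend on the path only through the current weight, so summing
  over the countably many paths up to time \<open>j\<close> that end in weight \<open>n\<close> gives the law of the step
  given the weight.\<close>

lemma emeasure_step:
  assumes n: "n \<ge> 1" and kr: "k \<ge> 1" "r \<ge> 1"
  shows "emeasure M {\<omega> \<in> space M. sum_mset (\<Lambda> j \<omega>) = n \<and> \<Lambda> (Suc j) \<omega> = \<Lambda> j \<omega> + replicate_mset r k}
    = ennreal (step_prob n k r) * emeasure M {\<omega> \<in> space M. sum_mset (\<Lambda> j \<omega>) = n}"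
proof -
  \<comment> \<open>paths are functions on \<open>{..j}\<close>, undefined elsewhere, which makes them countably many\<close>
  define X where "X = {x \<in> PiE {..j} (\<lambda>_. UNIV :: nat multiset set). sum_mset (x j) = n}"
  define A where "A = (\<lambda>x. {\<omega> \<in> space M. \<forall>i\<le>j. \<Lambda> i \<omega> = x i})"
  define B where "B = (\<lambda>x. {\<omega> \<in> space M. (\<forall>i\<le>j. \<Lambda> i \<omega> = x i) \<and> \<Lambda> (Suc j) \<omega> = x j + replicate_mset r k})"
  have X: "countable X" unfolding X_def
    by (rule countable_subset[of _ "PiE {..j} (\<lambda>_. UNIV)"]) (auto intro!: countable_PiE countable_nat_multisets)
  have [measurable]: "A x \<in> sets M" "B x \<in> sets M" for x unfolding A_def B_def by measurable
  have disjA: "disjoint_family_on A X"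
  proof (unfold disjoint_family_on_def, intro ballI impI)
    fix x x' assume x: "x \<in> X" "x' \<in> X" "x \<noteq> x'"
    show "A x \<inter> A x' = {}"
    proof (rule ccontr)
      assume "A x \<inter> A x' \<noteq> {}"
      then obtain \<omega> where "\<forall>i\<le>j. \<Lambda> i \<omega> = x i" "\<forall>i\<le>j. \<Lambda> i \<omega> = x' i" unfolding A_def by blast
      hence "x = x'" using x by (intro PiE_ext[of x "{..j}" "\<lambda>_. UNIV"]) (auto simp: X_def)
      thus False using x by simp
    qed
  qed
  have "B x \<subseteq> A x" for x by (auto simp: A_def B_def)
  hence disjB: "disjoint_family_on B X" using disjA unfolding disjoint_family_on_def by blast
  have path: "restrict (\<lambda>i. \<Lambda> i \<omega>) {..j} \<in> X" if "sum_mset (\<Lambda> j \<omega>) = n" for \<omega>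
    using that by (auto simp: X_def)
  have UA: "{\<omega> \<in> space M. sum_mset (\<Lambda> j \<omega>) = n} = (\<Union>x\<in>X. A x)"
    using path by (fastforce simp: A_def X_def)
  have UB: "{\<omega> \<in> space M. sum_mset (\<Lambda> j \<omega>) = n \<and> \<Lambda> (Suc j) \<omega> = \<Lambda> j \<omega> + replicate_mset r k} = (\<Union>x\<in>X. B x)"
    using path by (fastforce simp: B_def X_def)
  have "emeasure M (\<Union>x\<in>X. B x) = (\<integral>\<^sup>+x. emeasure M (B x) \<partial>count_space X)"
    by (rule emeasure_UN_countable) (use X disjB in auto)
  also have "\<dots> = (\<integral>\<^sup>+x. ennreal (step_prob n k r) * emeasure M (A x) \<partial>count_space X)"
    unfolding A_def B_def
    by (intro nn_integral_cong emeasure_step_path n kr) (simp add: X_def)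
  also have "\<dots> = ennreal (step_prob n k r) * (\<integral>\<^sup>+x. emeasure M (A x) \<partial>count_space X)"
    by (rule nn_integral_cmult) simp
  also have "(\<integral>\<^sup>+x. emeasure M (A x) \<partial>count_space X) = emeasure M (\<Union>x\<in>X. A x)"
    by (rule emeasure_UN_countable[symmetric]) (use X disjA in auto)
  finally show ?thesis unfolding UA UB .
qed

text \<open>Expectations of functions of the step. Both indices are shifted, since part sizes and
  multiplicities start at 1; that the step exists almost surely is what excludes missing mass.\<close>

lemma nn_integral_step:
  fixes f :: "nat \<Rightarrow> nat \<Rightarrow> ennreal"
  assumes n: "n \<ge> 1" and pos: "\<P>(\<omega> in M. sum_mset (\<Lambda> j \<omega>) = n) > 0"
  shows "(\<integral>\<^sup>+\<omega>. f (K \<Lambda> j \<omega>) (R \<Lambda> j \<omega>) \<partial>cond_measure M \<Lambda> j n)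
    = (\<Sum>k. \<Sum>r. f (Suc k) (Suc r) * ennreal (step_prob n (Suc k) (Suc r)))"
proof -
  define A where "A = {\<omega> \<in> space M. sum_mset (\<Lambda> j \<omega>) = n}"
  define B where "B = (\<lambda>k r. {\<omega> \<in> space M. sum_mset (\<Lambda> j \<omega>) = n
      \<and> \<Lambda> (Suc j) \<omega> = \<Lambda> j \<omega> + replicate_mset r k})"
  have A [measurable]: "A \<in> sets M" unfolding A_def by (rule sets_state_eq)
  have B [measurable]: "B k r \<in> sets M" for k r
    using measurable_sets[OF measurable_two_states[of "\<lambda>\<mu> \<nu>. sum_mset \<mu> = n \<and> \<nu> = \<mu> + replicate_mset r k" j "Suc j"], of "{True}"]
    unfolding B_def by (simp add: vimage_def Int_def conj_commute)
  have [measurable]: "(\<lambda>\<omega>. f (K \<Lambda> j \<omega>) (R \<Lambda> j \<omega>)) \<in> borel_measurable M"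
    by measurable
  have EA: "emeasure M A \<noteq> 0" "emeasure M A \<noteq> \<top>"
    using pos by (auto simp: emeasure_eq_measure A_def)
  have "(\<integral>\<^sup>+\<omega>. f (K \<Lambda> j \<omega>) (R \<Lambda> j \<omega>) \<partial>cond_measure M \<Lambda> j n)
     = (\<integral>\<^sup>+\<omega>. f (K \<Lambda> j \<omega>) (R \<Lambda> j \<omega>) * indicator A \<omega> \<partial>M) / emeasure M A"
    unfolding cond_measure_def A_def[symmetric] by (rule nn_integral_uniform_measure) measurable
  also have "(\<integral>\<^sup>+\<omega>. f (K \<Lambda> j \<omega>) (R \<Lambda> j \<omega>) * indicator A \<omega> \<partial>M)
     = (\<integral>\<^sup>+\<omega>. (\<Sum>k. \<Sum>r. f (Suc k) (Suc r) * indicator (B (Suc k) (Suc r)) \<omega>) \<partial>M)"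
  proof (rule nn_integral_cong_AE)
    show "AE \<omega> in M. f (K \<Lambda> j \<omega>) (R \<Lambda> j \<omega>) * indicator A \<omega>
       = (\<Sum>k. \<Sum>r. f (Suc k) (Suc r) * indicator (B (Suc k) (Suc r)) \<omega>)"
      using step[of j] AE_space
    proof eventually_elim
      case (elim \<omega>)
      then obtain k0 r0 where kr: "adds_parts (\<Lambda> j \<omega>) (\<Lambda> (Suc j) \<omega>) k0 r0" by blast
      obtain k r where Suc: "k0 = Suc k" "r0 = Suc r"
        using kr unfolding adds_parts_def by (metis One_nat_def Suc_le_D)
      have ind: "indicator (B (Suc k') (Suc r')) \<omega> = (if k' = k \<and> r' = r then indicator A \<omega> else (0::ennreal))" for k' r'
        using kr elim(2) replicate_mset_eq_iff[of "Suc r'" "Suc k'" "Suc r" "Suc k"]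
        by (auto simp: B_def A_def adds_parts_def Suc indicator_def simp del: replicate_mset_Suc)
      have row: "(\<Sum>r'. f (Suc k') (Suc r') * indicator (B (Suc k') (Suc r')) \<omega>)
          = (if k' = k then f (Suc k) (Suc r) * indicator A \<omega> else 0)" for k'
        by (subst suminf_finite[of "{r}"]) (auto simp: ind)
      have col: "(\<Sum>k'. if k' = k then c else 0) = c" for c :: ennreal
        by (subst suminf_finite[of "{k}"]) auto
      show ?case unfolding row col K_R_eqI[of \<Lambda>, OF kr] Suc ..
    qed
  qed
  also have "\<dots> = (\<Sum>k. \<Sum>r. f (Suc k) (Suc r) * emeasure M (B (Suc k) (Suc r)))"
    by (simp add: nn_integral_suminf nn_integral_cmult_indicator)
  also have "\<dots> = (\<Sum>k. \<Sum>r. f (Suc k) (Suc r) * ennreal (step_prob n (Suc k) (Suc r)) * emeasure M A)"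
    unfolding B_def A_def by (intro suminf_cong, subst emeasure_step[OF n]) (auto simp: mult.assoc)
  also have "\<dots> = (\<Sum>k. \<Sum>r. f (Suc k) (Suc r) * ennreal (step_prob n (Suc k) (Suc r))) * emeasure M A"
    by simp
  also have "\<dots> / emeasure M A = (\<Sum>k. \<Sum>r. f (Suc k) (Suc r) * ennreal (step_prob n (Suc k) (Suc r)))"
    using EA by (simp add: ennreal_mult_divide_eq)
  finally show ?thesis .
qed

end

context partition_chain
begin

lemma measurable_K_R: "(\<lambda>\<omega>. f (K \<Lambda> j \<omega>) (R \<Lambda> j \<omega>) :: real) \<in> borel_measurable (cond_measure M \<Lambda> j n)"
proof -
  have "(\<lambda>\<omega>. f (K \<Lambda> j \<omega>) (R \<Lambda> j \<omega>)) \<in> borel_measurable M" by measurable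
  moreover have "sets (cond_measure M \<Lambda> j n) = sets M" by (simp add: cond_measure_def)
  ultimately show ?thesis by (simp cong: measurable_cong_sets)
qed

lemma nn_integral_step_real:
  fixes f :: "nat \<Rightarrow> nat \<Rightarrow> real"
  assumes n: "n \<ge> 1" and pos: "\<P>(\<omega> in M. sum_mset (\<Lambda> j \<omega>) = n) > 0" and f: "\<And>k r. f k r \<ge> 0"
  shows "(\<integral>\<^sup>+\<omega>. ennreal (f (K \<Lambda> j \<omega>) (R \<Lambda> j \<omega>)) \<partial>cond_measure M \<Lambda> j n)
    = (\<Sum>k. \<Sum>r. ennreal (f (Suc k) (Suc r) * step_prob n (Suc k) (Suc r)))"
  by (subst nn_integral_step[OF n pos, of "\<lambda>k r. ennreal (f k r)"])
     (simp add: ennreal_mult f step_prob_nonneg[OF n])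

lemma cond_prob_step:
  assumes pos: "\<P>(\<omega> in M. sum_mset (\<Lambda> j \<omega>) = n) > 0"
  shows "\<P>(\<omega> in M. P (K \<Lambda> j \<omega>) (R \<Lambda> j \<omega>) \<bar> sum_mset (\<Lambda> j \<omega>) = n)
    = (\<integral>\<omega>. of_bool (P (K \<Lambda> j \<omega>) (R \<Lambda> j \<omega>)) \<partial>cond_measure M \<Lambda> j n)"
proof -
  define A where "A = {\<omega> \<in> space M. sum_mset (\<Lambda> j \<omega>) = n}"
  define B where "B = {\<omega> \<in> space M. P (K \<Lambda> j \<omega>) (R \<Lambda> j \<omega>)}"
  have [measurable]: "A \<in> sets M" unfolding A_def by (rule sets_state_eq)
  have [measurable]: "B \<in> sets M" unfolding B_def by measurable
  have EA: "emeasure M A \<noteq> 0" "emeasure M A \<noteq> \<infinity>"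
    using pos by (auto simp: emeasure_eq_measure A_def)
  have "(\<integral>\<omega>. of_bool (P (K \<Lambda> j \<omega>) (R \<Lambda> j \<omega>)) \<partial>cond_measure M \<Lambda> j n)
      = (\<integral>\<omega>. indicator B \<omega> \<partial>uniform_measure M A :: real)"
    unfolding cond_measure_def A_def[symmetric]
    by (intro Bochner_Integration.integral_cong) (auto simp: B_def indicator_def)
  also have "\<dots> = measure (uniform_measure M A) B" by simp
  also have "\<dots> = measure M (A \<inter> B) / measure M A" using EA by (intro measure_uniform_measure) auto
  also have "A \<inter> B = {\<omega> \<in> space M. P (K \<Lambda> j \<omega>) (R \<Lambda> j \<omega>) \<and> sum_mset (\<Lambda> j \<omega>) = n}"
    by (auto simp: A_def B_def)
  finally show ?thesis by (simp add: cond_prob_def A_def)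
qed

lemma cond_expectation_tendsto:
  fixes F :: "nat \<Rightarrow> nat \<Rightarrow> nat \<Rightarrow> real" and L :: "real \<Rightarrow> nat \<Rightarrow> real" and j :: "nat \<Rightarrow> nat"
  assumes pos: "\<forall>\<^sub>F n in sequentially. \<P>(\<omega> in M. sum_mset (\<Lambda> (j n) \<omega>) = n) > 0"
    and nonneg: "\<And>n k r. F n k r \<ge> 0"
    and bound: "\<And>n k r. n \<ge> 1 \<Longrightarrow> k \<ge> 1 \<Longrightarrow> r \<ge> 1 \<Longrightarrow>
      F n k r \<le> C * (1 + real r * (real k / sqrt (real n))) ^ \<nu>"
    and lim: "AE y in lborel. y > 0 \<longrightarrow> (\<forall>r\<ge>1. (\<lambda>n. F n (nat \<lceil>y * sqrt (real n)\<rceil>) r) \<longlonglongrightarrow> L y r)"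
    and meas: "\<And>r. (\<lambda>y. L y r) \<in> borel_measurable borel"
  defines "I \<equiv> (\<integral>\<^sup>+y. ennreal (\<Sum>r. L y (Suc r) * (y * exp (- pi * y / sqrt 6) ^ Suc r))
            * indicator {0<..} y \<partial>lborel)"
  shows "(\<lambda>n. \<integral>\<omega>. F n (K \<Lambda> (j n) \<omega>) (R \<Lambda> (j n) \<omega>) \<partial>cond_measure M \<Lambda> (j n) n) \<longlonglongrightarrow> enn2real I"
    and "\<forall>\<^sub>F n in sequentially. integrable (cond_measure M \<Lambda> (j n) n) (\<lambda>\<omega>. F n (K \<Lambda> (j n) \<omega>) (R \<Lambda> (j n) \<omega>))"
proof -
  define S where "S = (\<lambda>n. \<Sum>k. \<Sum>r. ennreal (F n (Suc k) (Suc r) * step_prob n (Suc k) (Suc r)))"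
  note S_lim = step_sum_tendsto[OF nonneg bound lim meas, folded S_def I_def]
  have "(\<lambda>n. enn2real (S n)) \<longlonglongrightarrow> enn2real I"
    using S_lim(1,3) by (intro tendsto_enn2real) auto
  moreover have "\<forall>\<^sub>F n in sequentially. enn2real (S n)
     = (\<integral>\<omega>. F n (K \<Lambda> (j n) \<omega>) (R \<Lambda> (j n) \<omega>) \<partial>cond_measure M \<Lambda> (j n) n)"
    using pos eventually_ge_at_top[of 1]
  proof eventually_elim
    case (elim n)
    show ?case unfolding S_def
      using nn_integral_step_real[OF elim(2,1), of "F n"] nonneg
      by (subst integral_eq_nn_integral) (auto intro!: measurable_K_R)
  qed
  ultimately show "(\<lambda>n. \<integral>\<omega>. F n (K \<Lambda> (j n) \<omega>) (R \<Lambda> (j n) \<omega>) \<partial>cond_measure M \<Lambda> (j n) n) \<longlonglongrightarrow> enn2real I"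
    by (rule Lim_transform_eventually)
  show "\<forall>\<^sub>F n in sequentially. integrable (cond_measure M \<Lambda> (j n) n) (\<lambda>\<omega>. F n (K \<Lambda> (j n) \<omega>) (R \<Lambda> (j n) \<omega>))"
    using pos eventually_ge_at_top[of 1]
  proof eventually_elim
    case (elim n)
    show ?case
      using S_lim(2)[of n] nn_integral_step_real[OF elim(2,1), of "F n"] nonneg elim(2)
      by (intro integrableI_nonneg measurable_K_R) (auto simp: S_def)
  qed
qed

text \<open>Both the joint event and the conditioning event are evaluated given the weight; the
  normalization is the row sum of the step probabilities.\<close>

lemma cond_prob_K_R:
  assumes n: "n \<ge> 1" and pos: "\<P>(\<omega> in M. sum_mset (\<Lambda> j \<omega>) = n) > 0" and k: "k \<ge> 1" and r: "r \<ge> 1"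
  shows "\<P>(\<omega> in M. R \<Lambda> j \<omega> = r \<bar> K \<Lambda> j \<omega> = k \<and> sum_mset (\<Lambda> j \<omega>) = n)
    = step_prob n k r / (\<Sum>r'. step_prob n k (Suc r'))"
proof -
  obtain k0 r0 where Suc: "k = Suc k0" "r = Suc r0" using k r by (metis One_nat_def Suc_le_D)
  have E: "\<P>(\<omega> in M. P (K \<Lambda> j \<omega>) (R \<Lambda> j \<omega>) \<bar> sum_mset (\<Lambda> j \<omega>) = n)
    = enn2real (\<Sum>k. \<Sum>r. ennreal (of_bool (P (Suc k) (Suc r)) * step_prob n (Suc k) (Suc r)))" for P
    unfolding cond_prob_step[OF pos]
    using nn_integral_step_real[OF n pos, of "\<lambda>k r. of_bool (P k r)"]
      measurable_K_R[of "\<lambda>k r. of_bool (P k r)" j n]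
    by (subst integral_eq_nn_integral) auto
  have "(\<Sum>r'. ennreal (of_bool (Suc k' = k \<and> Suc r' = r) * step_prob n (Suc k') (Suc r')))
      = (if k' = k0 then ennreal (step_prob n k r) else 0)" for k'
    by (subst suminf_finite[of "{r0}"]) (auto simp: Suc)
  hence "\<P>(\<omega> in M. K \<Lambda> j \<omega> = k \<and> R \<Lambda> j \<omega> = r \<bar> sum_mset (\<Lambda> j \<omega>) = n)
      = enn2real (\<Sum>k'. if k' = k0 then ennreal (step_prob n k r) else 0)"
    by (simp only: E[of "\<lambda>k' r'. k' = k \<and> r' = r"])
  also have "(\<Sum>k'. if k' = k0 then ennreal (step_prob n k r) else 0) = ennreal (step_prob n k r)"
    by (subst suminf_finite[of "{k0}"]) auto
  finally have 1: "\<P>(\<omega> in M. K \<Lambda> j \<omega> = k \<and> R \<Lambda> j \<omega> = r \<bar> sum_mset (\<Lambda> j \<omega>) = n) = step_prob n k r"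
    using step_prob_nonneg[OF n] by simp
  have "(\<Sum>r'. ennreal (of_bool (Suc k' = k) * step_prob n (Suc k') (Suc r')))
      = (if k' = k0 then ennreal (\<Sum>r'. step_prob n k (Suc r')) else 0)" for k'
    using summable_step_prob[OF n k] step_prob_nonneg[OF n]
    by (auto simp: Suc intro!: suminf_ennreal2)
  hence "\<P>(\<omega> in M. K \<Lambda> j \<omega> = k \<bar> sum_mset (\<Lambda> j \<omega>) = n)
      = enn2real (\<Sum>k'. if k' = k0 then ennreal (\<Sum>r'. step_prob n k (Suc r')) else 0)"
    by (simp only: E[of "\<lambda>k' r'. k' = k"])
  also have "(\<Sum>k'. if k' = k0 then ennreal (\<Sum>r'. step_prob n k (Suc r')) else 0)
      = ennreal (\<Sum>r'. step_prob n k (Suc r'))"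
    by (subst suminf_finite[of "{k0}"]) auto
  finally have 2: "\<P>(\<omega> in M. K \<Lambda> j \<omega> = k \<bar> sum_mset (\<Lambda> j \<omega>) = n) = (\<Sum>r'. step_prob n k (Suc r'))"
    using step_prob_nonneg[OF n] summable_step_prob[OF n k] by (simp add: suminf_nonneg)
  have "\<P>(\<omega> in M. R \<Lambda> j \<omega> = r \<bar> K \<Lambda> j \<omega> = k \<and> sum_mset (\<Lambda> j \<omega>) = n)
     = \<P>(\<omega> in M. K \<Lambda> j \<omega> = k \<and> R \<Lambda> j \<omega> = r \<bar> sum_mset (\<Lambda> j \<omega>) = n)
       / \<P>(\<omega> in M. K \<Lambda> j \<omega> = k \<bar> sum_mset (\<Lambda> j \<omega>) = n)"
  proof -
    have "{\<omega> \<in> space M. R \<Lambda> j \<omega> = r \<and> K \<Lambda> j \<omega> = k \<and> sum_mset (\<Lambda> j \<omega>) = n}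
       = {\<omega> \<in> space M. (K \<Lambda> j \<omega> = k \<and> R \<Lambda> j \<omega> = r) \<and> sum_mset (\<Lambda> j \<omega>) = n}" by auto
    thus ?thesis using pos by (simp add: cond_prob_def)
  qed
  thus ?thesis unfolding 1 2 .
qed

end

section \<open>Evaluation of the limiting integrals\<close>

lemma eventually_nat_ceiling_iff:
  assumes "y > 0" "y \<noteq> x"
  shows "\<forall>\<^sub>F n in sequentially. (real (nat \<lceil>y * sqrt (real n)\<rceil>) \<le> x * sqrt (real n) \<longleftrightarrow> y \<le> x)
     \<and> (x * sqrt (real n) \<le> real (nat \<lceil>y * sqrt (real n)\<rceil>) \<longleftrightarrow> x \<le> y)"
proof -
  note lim = nat_ceiling_div_tendsto[OF assms(1)]
  consider "y < x" | "x < y" using assms by linarith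
  thus ?thesis
  proof cases
    case 1
    show ?thesis using order_tendstoD(2)[OF lim 1] eventually_gt_at_top[of 0]
      by eventually_elim (use 1 in \<open>auto simp: field_simps\<close>)
  next
    case 2
    show ?thesis using order_tendstoD(1)[OF lim 2] eventually_gt_at_top[of 0]
      by eventually_elim (use 2 in \<open>auto simp: field_simps\<close>)
  qed
qed

lemma exp_decay_less_1: "y > 0 \<Longrightarrow> exp (- pi * y / sqrt 6) < (1::real)"
  by simp

lemma geometric_Suc_sums:
  assumes "0 \<le> q" "q < (1::real)"
  shows "(\<lambda>r. y * q ^ Suc r) sums (y * q / (1 - q))"
  using sums_mult[OF geometric_sums[of q], of "y * q"] assms by (simp add: mult_ac)

lemma geometric_deriv_Suc_sums:
  assumes "0 \<le> q" "q < (1::real)"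
  shows "(\<lambda>r. real (Suc r) * (y * q ^ Suc r)) sums (y * q / (1 - q)\<^sup>2)"
  using sums_mult[OF geometric_deriv_sums[of q], of "y * q"] assms by (simp add: mult_ac del: of_nat_Suc)

text \<open>The limiting distribution function of \<open>K\<close>: the sum over \<open>r\<close> is geometric.\<close>

lemma nn_integral_limit_K:
  assumes x: "x > 0"
  shows "(\<integral>\<^sup>+y. ennreal (\<Sum>r. of_bool (y \<le> x) * (y * exp (- pi * y / sqrt 6) ^ Suc r))
            * indicator {0<..} y \<partial>lborel)
     = ennreal (integral {0..x} (\<lambda>y. y * exp (- pi * y / sqrt 6) / (1 - exp (- pi * y / sqrt 6))))"
    and "integral {0..x} (\<lambda>y. y * exp (- pi * y / sqrt 6) / (1 - exp (- pi * y / sqrt 6))) \<ge> 0"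
proof -
  define \<phi> where "\<phi> = (\<lambda>y. y * exp (- pi * y / sqrt 6) / (1 - exp (- pi * y / sqrt 6)))"
  have \<phi>0: "0 \<le> \<phi> y" if "y \<ge> 0" for y
    unfolding \<phi>_def using that by (intro divide_nonneg_nonneg) auto
  have \<phi>1: "\<phi> y \<le> 1" if "y \<ge> 0" for y
  proof (cases "y = 0")
    case False
    define u where "u = pi * y / sqrt 6"
    have "sqrt 6 \<le> sqrt (3^2)" by (intro real_sqrt_le_mono) simp
    hence "sqrt 6 \<le> pi" using pi_gt3 by simp
    hence "y * sqrt 6 \<le> y * pi" using that by (intro mult_left_mono) auto
    hence u: "y \<le> u" "u > 0" using that False by (auto simp: u_def field_simps)
    have "y \<le> exp u - 1" using exp_ge_add_one_self[of u] u by linarith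
    hence "y * exp (- u) \<le> (exp u - 1) * exp (- u)" by (intro mult_right_mono) auto
    also have "\<dots> = 1 - exp (- u)" by (simp add: algebra_simps flip: exp_add)
    finally show ?thesis using u by (simp add: \<phi>_def u_def[symmetric])
  qed (simp add: \<phi>_def)
  have [measurable]: "\<phi> \<in> borel_measurable borel" unfolding \<phi>_def by measurable
  have int: "set_integrable lborel {0..x} \<phi>"
    unfolding set_integrable_def
    by (rule integrableI_bounded_set_indicator[where B = 1]) (use x \<phi>0 \<phi>1 in auto)
  note eq = set_borel_integral_eq_integral[OF int]
  have "(\<integral>\<^sup>+y. ennreal (\<Sum>r. of_bool (y \<le> x) * (y * exp (- pi * y / sqrt 6) ^ Suc r))
            * indicator {0<..} y \<partial>lborel) = (\<integral>\<^sup>+y. ennreal (indicator {0..x} y * \<phi> y) \<partial>lborel)"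
  proof (intro nn_integral_cong)
    fix y :: real
    show "ennreal (\<Sum>r. of_bool (y \<le> x) * (y * exp (- pi * y / sqrt 6) ^ Suc r)) * indicator {0<..} y
       = ennreal (indicator {0..x} y * \<phi> y)"
    proof (cases "y > 0")
      case True
      have "(\<Sum>r. y * exp (- pi * y / sqrt 6) ^ Suc r) = \<phi> y"
        unfolding \<phi>_def using geometric_Suc_sums[OF _ exp_decay_less_1[OF True]]
        by (intro sums_unique[symmetric]) auto
      thus ?thesis using True by (auto simp: indicator_def simp del: power_Suc)
    next
      case False
      thus ?thesis by (cases "y = 0") (auto simp: \<phi>_def indicator_def)
    qed
  qed
  also have "\<dots> = ennreal (\<integral>y. indicator {0..x} y * \<phi> y \<partial>lborel)"
    using int \<phi>0 by (intro nn_integral_eq_integral) (auto simp: set_integrable_def indicator_def)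
  also have "(\<integral>y. indicator {0..x} y * \<phi> y \<partial>lborel) = integral {0..x} \<phi>"
    using eq(2) by (simp add: set_lebesgue_integral_def)
  finally show "(\<integral>\<^sup>+y. ennreal (\<Sum>r. of_bool (y \<le> x) * (y * exp (- pi * y / sqrt 6) ^ Suc r))
            * indicator {0<..} y \<partial>lborel)
     = ennreal (integral {0..x} (\<lambda>y. y * exp (- pi * y / sqrt 6) / (1 - exp (- pi * y / sqrt 6))))"
    unfolding \<phi>_def .
  show "integral {0..x} (\<lambda>y. y * exp (- pi * y / sqrt 6) / (1 - exp (- pi * y / sqrt 6))) \<ge> 0"
    using eq(1) \<phi>0 unfolding \<phi>_def by (intro integral_nonneg) auto
qed

lemma nn_integral_square_exp:
  assumes b: "b > (0::real)" and c: "c \<ge> 0"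
  shows "(\<integral>\<^sup>+y. ennreal (c * y\<^sup>2 * exp (- b * y)) * indicator {0<..} y \<partial>lborel) = ennreal (2 * c / b ^ 3)"
proof -
  have "(\<integral>\<^sup>+y. ennreal (c * y\<^sup>2 * exp (- b * y)) * indicator {0<..} y \<partial>lborel)
     = (\<integral>\<^sup>+y. ennreal (c * y\<^sup>2 * exp (- b * y)) * indicator {0..} y \<partial>lborel)"
    by (intro nn_integral_cong_AE AE_I[of _ _ "{0}"]) (auto simp: indicator_def)
  also have "\<dots> = ennreal (0 - (- c * exp (- b * 0) * (0\<^sup>2 / b + 2 * 0 / b\<^sup>2 + 2 / b ^ 3)))"
  proof (rule nn_integral_FTC_atLeast)
    show "((\<lambda>y. - c * exp (- b * y) * (y\<^sup>2 / b + 2 * y / b\<^sup>2 + 2 / b ^ 3)) has_real_derivative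
        c * y\<^sup>2 * exp (- b * y)) (at y)" for y
      using b by (auto intro!: derivative_eq_intros simp: field_simps power2_eq_square power3_eq_cube)
    show "((\<lambda>y. - c * exp (- b * y) * (y\<^sup>2 / b + 2 * y / b\<^sup>2 + 2 / b ^ 3)) \<longlongrightarrow> 0) at_top"
      using b by real_asymp
  qed (use c in auto)
  finally show ?thesis by (simp add: mult_ac)
qed

text \<open>Exchanging sum and integral leaves \<open>2 zeta(2) / a^3\<close> with \<open>a = pi / sqrt 6\<close>, which is \<open>2 / a\<close>
  because \<open>zeta(2) = a^2\<close>.\<close>

lemma nn_integral_limit_mean:
  "(\<integral>\<^sup>+y. ennreal (\<Sum>r. (y * real (Suc r)) * (y * exp (- pi * y / sqrt 6) ^ Suc r))
      * indicator {0<..} y \<partial>lborel) = ennreal (2 * sqrt 6 / pi)"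
proof -
  define a where "a = pi / sqrt 6"
  have a: "a > 0" "a\<^sup>2 = pi\<^sup>2 / 6" by (auto simp: a_def power_divide)
  have "(\<integral>\<^sup>+y. ennreal (\<Sum>r. (y * real (Suc r)) * (y * exp (- pi * y / sqrt 6) ^ Suc r))
      * indicator {0<..} y \<partial>lborel)
    = (\<integral>\<^sup>+y. (\<Sum>r. ennreal (real (Suc r) * y\<^sup>2 * exp (- (a * real (Suc r)) * y)) * indicator {0<..} y) \<partial>lborel)"
  proof (intro nn_integral_cong)
    fix y :: real
    show "ennreal (\<Sum>r. (y * real (Suc r)) * (y * exp (- pi * y / sqrt 6) ^ Suc r)) * indicator {0<..} y
      = (\<Sum>r. ennreal (real (Suc r) * y\<^sup>2 * exp (- (a * real (Suc r)) * y)) * indicator {0<..} y)"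
    proof (cases "y > 0")
      case True
      have eq: "(y * real (Suc r)) * (y * exp (- pi * y / sqrt 6) ^ Suc r)
          = real (Suc r) * y\<^sup>2 * exp (- (a * real (Suc r)) * y)" for r
      proof -
        have "exp (- pi * y / sqrt 6) ^ Suc r = exp (real (Suc r) * (- pi * y / sqrt 6))"
          by (rule exp_of_nat_mult[symmetric])
        also have "real (Suc r) * (- pi * y / sqrt 6) = - (a * real (Suc r)) * y"
          by (simp add: a_def del: of_nat_Suc)
        finally show ?thesis by (simp add: power2_eq_square mult_ac del: of_nat_Suc)
      qed
      have "summable (\<lambda>r. y * (real (Suc r) * (y * exp (- pi * y / sqrt 6) ^ Suc r)))"
        using geometric_deriv_Suc_sums[OF _ exp_decay_less_1[OF True], of y]
        by (intro summable_mult) (auto simp: sums_iff)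
      hence "summable (\<lambda>r. (y * real (Suc r)) * (y * exp (- pi * y / sqrt 6) ^ Suc r))"
        by (simp only: mult.assoc)
      hence "summable (\<lambda>r. real (Suc r) * y\<^sup>2 * exp (- (a * real (Suc r)) * y))"
        unfolding eq .
      hence "(\<Sum>r. ennreal (real (Suc r) * y\<^sup>2 * exp (- (a * real (Suc r)) * y)))
         = ennreal (\<Sum>r. real (Suc r) * y\<^sup>2 * exp (- (a * real (Suc r)) * y))"
        by (intro suminf_ennreal2) auto
      thus ?thesis unfolding eq using True by simp
    qed simp
  qed
  also have "\<dots> = (\<Sum>r. \<integral>\<^sup>+y. ennreal (real (Suc r) * y\<^sup>2 * exp (- (a * real (Suc r)) * y)) * indicator {0<..} y \<partial>lborel)"
    by (intro nn_integral_suminf) auto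
  also have "\<dots> = (\<Sum>r. ennreal (2 / a ^ 3 * (1 / (real r + 1)\<^sup>2)))"
  proof (intro suminf_cong)
    fix r
    have "2 * c / (a * c) ^ 3 = 2 / a ^ 3 * (1 / c\<^sup>2)" if "c > 0" for c :: real
      using a that by (simp add: power_mult_distrib power3_eq_cube power2_eq_square)
    from this[of "real (Suc r)"]
    show "(\<integral>\<^sup>+y. ennreal (real (Suc r) * y\<^sup>2 * exp (- (a * real (Suc r)) * y)) * indicator {0<..} y \<partial>lborel)
       = ennreal (2 / a ^ 3 * (1 / (real r + 1)\<^sup>2))"
      using a by (subst nn_integral_square_exp) (auto simp: add_ac)
  qed
  also have "\<dots> = ennreal (2 / a ^ 3 * (pi\<^sup>2 / 6))"
  proof -
    have "(\<lambda>r. 2 / a ^ 3 * (1 / (real r + 1)\<^sup>2)) sums (2 / a ^ 3 * (pi\<^sup>2 / 6))"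
      using sums_mult[OF inverse_squares_sums, of "2 / a ^ 3"] by (simp add: add_ac)
    thus ?thesis using a(1) by (subst suminf_ennreal2) (simp_all only: sums_iff, auto)
  qed
  also have "2 / a ^ 3 * (pi\<^sup>2 / 6) = 2 / a"
    unfolding a(2)[symmetric] using a by (simp add: power3_eq_cube power2_eq_square)
  also have "2 / a = 2 * sqrt 6 / pi" by (simp add: a_def)
  finally show ?thesis .
qed

text \<open>The sum over \<open>r\<close> gives \<open>y q / (1 - q)^2\<close> with \<open>q = exp (- pi y / sqrt 6)\<close>, and this is minus the
  derivative of \<open>h\<close>.\<close>

lemma nn_integral_limit_R:
  assumes x: "x > 0"
  defines "h \<equiv> \<lambda>x. sqrt 6 * x * exp (- pi * x / sqrt 6) / (pi * (1 - exp (- pi * x / sqrt 6)))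
              - 6 * ln (1 - exp (- pi * x / sqrt 6)) / pi\<^sup>2"
  shows "(\<integral>\<^sup>+y. ennreal (\<Sum>r. (real (Suc r) * of_bool (x \<le> y)) * (y * exp (- pi * y / sqrt 6) ^ Suc r))
      * indicator {0<..} y \<partial>lborel) = ennreal (h x)" and "h x \<ge> 0"
proof -
  define q where "q = (\<lambda>y. exp (- pi * y / sqrt 6))"
  have q: "q y > 0" "y > 0 \<Longrightarrow> q y < 1" for y by (auto simp: q_def)
  have "(\<integral>\<^sup>+y. ennreal (\<Sum>r. (real (Suc r) * of_bool (x \<le> y)) * (y * q y ^ Suc r)) * indicator {0<..} y \<partial>lborel)
    = (\<integral>\<^sup>+y. ennreal (y * q y / (1 - q y)\<^sup>2) * indicator {x..} y \<partial>lborel)"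
  proof (intro nn_integral_cong)
    fix y :: real
    show "ennreal (\<Sum>r. (real (Suc r) * of_bool (x \<le> y)) * (y * q y ^ Suc r)) * indicator {0<..} y
      = ennreal (y * q y / (1 - q y)\<^sup>2) * indicator {x..} y"
    proof (cases "x \<le> y")
      case True
      hence "y > 0" using x by simp
      hence "(\<lambda>r. real (Suc r) * (y * q y ^ Suc r)) sums (y * q y / (1 - q y)\<^sup>2)"
        using q by (intro geometric_deriv_Suc_sums) (auto intro: less_imp_le)
      thus ?thesis using True \<open>y > 0\<close> by (simp add: sums_iff del: of_nat_Suc power_Suc)
    qed simp
  qed
  also have "\<dots> = ennreal (0 - (- h x))"
  proof (rule nn_integral_FTC_atLeast)
    show "((\<lambda>y. - h y) has_real_derivative y * q y / (1 - q y)\<^sup>2) (at y)" if "x \<le> y" for y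
    proof -
      have y: "y > 0" using that x by simp
      define c where "c = sqrt 6 / pi"
      have c: "c > 0" "c\<^sup>2 = 6 / pi\<^sup>2" by (auto simp: c_def power_divide)
      have h_eq: "h = (\<lambda>y. c * (y * q y / (1 - q y)) - c\<^sup>2 * ln (1 - q y))"
        by (simp add: h_def q_def c(2) fun_eq_iff) (simp add: c_def)
      have dq: "(q has_real_derivative - (q y / c)) (at y)"
      proof -
        have "q = (\<lambda>y. exp (- (y / c)))" by (simp add: q_def c_def fun_eq_iff mult.commute)
        thus ?thesis using c(1) by (auto intro!: derivative_eq_intros)
      qed
      have pos: "1 - q y > 0" "1 - q y \<noteq> 0" using q(2)[OF y] by auto
      note d1 = DERIV_mult[OF DERIV_ident dq]
      note d2 = DERIV_diff[OF DERIV_const[of 1] dq]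
      note d3 = DERIV_divide[OF d1 d2 pos(2)]
      note d4 = DERIV_chain2[OF DERIV_ln_divide[OF pos(1)] d2]
      have "((\<lambda>y. - (c * (y * q y / (1 - q y)) - c\<^sup>2 * ln (1 - q y))) has_real_derivative
          - (c * (((1 * q y + - (q y / c) * y) * (1 - q y) - y * q y * (0 - - (q y / c))) / ((1 - q y) * (1 - q y)))
             - c\<^sup>2 * (1 / (1 - q y) * (0 - - (q y / c))))) (at y)"
        by (rule DERIV_minus[OF DERIV_diff[OF DERIV_cmult[OF d3] DERIV_cmult[OF d4]]])
      moreover have "- (c * (((1 * Q + - (Q / c) * y) * (1 - Q) - y * Q * (0 - - (Q / c))) / ((1 - Q) * (1 - Q)))
             - c\<^sup>2 * (1 / (1 - Q) * (0 - - (Q / c)))) = y * Q / (1 - Q)\<^sup>2" if "Q < 1" for Q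
      proof -
        define D where "D = 1 - Q"
        have Q: "Q = 1 - D" "D > 0" using that by (auto simp: D_def)
        show ?thesis unfolding Q(1) using Q(2) c(1) by (simp add: field_simps power2_eq_square)
      qed
      ultimately show ?thesis unfolding h_eq using q(2)[OF y] by simp
    qed
    show "((\<lambda>y. - h y) \<longlongrightarrow> 0) at_top" unfolding h_def by real_asymp
    show "0 \<le> y * q y / (1 - q y)\<^sup>2" if "x \<le> y" for y
      using that x q(1)[of y] by simp
    show "(\<lambda>y. y * q y / (1 - q y)\<^sup>2) \<in> borel_measurable borel" unfolding q_def by measurable
  qed
  finally show "(\<integral>\<^sup>+y. ennreal (\<Sum>r. (real (Suc r) * of_bool (x \<le> y)) * (y * exp (- pi * y / sqrt 6) ^ Suc r))
      * indicator {0<..} y \<partial>lborel) = ennreal (h x)" by (simp add: q_def)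
  have "ln (1 - q x) \<le> 0" using q(1)[of x] q(2)[of x] x by simp
  moreover have "sqrt 6 * x * q x / (pi * (1 - q x)) \<ge> 0"
    using q(1)[of x] q(2)[of x] x by (intro divide_nonneg_nonneg mult_nonneg_nonneg) auto
  moreover have "6 * ln (1 - q x) / pi\<^sup>2 \<le> 0"
    using calculation(1) by (intro divide_nonpos_nonneg) auto
  ultimately show "h x \<ge> 0" unfolding h_def q_def by linarith
qed

section \<open>Limit theorems for the chain\<close>

context partition_chain
begin

lemma K_distribution_tendsto:
  assumes pos: "\<forall>\<^sub>F n in sequentially. \<P>(\<omega> in M. sum_mset (\<Lambda> (j n) \<omega>) = n) > 0" and x: "x > 0"
  shows "(\<lambda>n. \<P>(\<omega> in M. real (K \<Lambda> (j n) \<omega>) \<le> x * sqrt (real n) \<bar> sum_mset (\<Lambda> (j n) \<omega>) = n))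
    \<longlonglongrightarrow> integral {0..x} (\<lambda>y. y * exp (- pi * y / sqrt 6) / (1 - exp (- pi * y / sqrt 6)))"
proof -
  \<comment> \<open>the indicators need not converge at the point \<open>y = x\<close>\<close>
  have "AE y in lborel. y \<noteq> x" by (rule AE_lborel_singleton)
  hence lim: "AE y in lborel. y > 0 \<longrightarrow> (\<forall>r\<ge>(1::nat).
      (\<lambda>n. of_bool (real (nat \<lceil>y * sqrt (real n)\<rceil>) \<le> x * sqrt (real n)) :: real) \<longlonglongrightarrow> of_bool (y \<le> x))"
  proof eventually_elim
    case (elim y)
    show ?case
    proof (intro impI allI)
      assume "y > 0"
      from eventually_nat_ceiling_iff[OF this elim]
      show "(\<lambda>n. of_bool (real (nat \<lceil>y * sqrt (real n)\<rceil>) \<le> x * sqrt (real n)) :: real) \<longlonglongrightarrow> of_bool (y \<le> x)"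
        by (intro tendsto_eventually) (auto elim: eventually_mono)
    qed
  qed
  have "(\<lambda>n. \<integral>\<omega>. of_bool (real (K \<Lambda> (j n) \<omega>) \<le> x * sqrt (real n)) \<partial>cond_measure M \<Lambda> (j n) n)
     \<longlonglongrightarrow> integral {0..x} (\<lambda>y. y * exp (- pi * y / sqrt 6) / (1 - exp (- pi * y / sqrt 6)))"
    using cond_expectation_tendsto(1)[OF pos,
        of "\<lambda>n k r. of_bool (real k \<le> x * sqrt (real n))" 1 0 "\<lambda>y r. of_bool (y \<le> x)"]
      lim nn_integral_limit_K[OF x]
    by simp
  thus ?thesis
    by (rule Lim_transform_eventually)
       (use pos in eventually_elim, rule cond_prob_step[symmetric, of _ _ "\<lambda>k r. real k \<le> x * sqrt (real _)"])
qed

lemma R_conditional_tendsto: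
  fixes k :: "nat \<Rightarrow> nat"
  assumes pos: "\<forall>\<^sub>F n in sequentially. \<P>(\<omega> in M. sum_mset (\<Lambda> (j n) \<omega>) = n) > 0" and x: "x > 0"
    and k: "\<And>n. k n \<ge> 1" and klim: "(\<lambda>n. real (k n) / sqrt (real n)) \<longlonglongrightarrow> x" and r: "r \<ge> 1"
  shows "(\<lambda>n. \<P>(\<omega> in M. R \<Lambda> (j n) \<omega> = r \<bar> K \<Lambda> (j n) \<omega> = k n \<and> sum_mset (\<Lambda> (j n) \<omega>) = n))
     \<longlonglongrightarrow> (1 - exp (- pi * x / sqrt 6)) * exp (- pi * x * (real r - 1) / sqrt 6)"
proof -
  define q where "q = exp (- pi * x / sqrt 6)"
  have q: "0 < q" "q < 1" using x by (auto simp: q_def)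
  have "(\<lambda>n. \<Sum>r'. 1 * (sqrt (real n) * step_prob n (k n) (Suc r'))) \<longlonglongrightarrow> (\<Sum>r'. 1 * (x * q ^ Suc r'))"
    unfolding q_def
    by (rule weighted_row_sum_tendsto[where C = 1 and \<nu> = 0]) (use x k klim in auto)
  also have "(\<Sum>r'. 1 * (x * q ^ Suc r')) = x * q / (1 - q)"
    using geometric_Suc_sums[of q x] q by (simp add: sums_iff)
  finally have den: "(\<lambda>n. \<Sum>r'. 1 * (sqrt (real n) * step_prob n (k n) (Suc r'))) \<longlonglongrightarrow> x * q / (1 - q)" .
  have lim: "(\<lambda>n. sqrt (real n) * step_prob n (k n) r / (\<Sum>r'. 1 * (sqrt (real n) * step_prob n (k n) (Suc r'))))
     \<longlonglongrightarrow> x * q ^ r / (x * q / (1 - q))"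
    using q x unfolding q_def by (intro tendsto_divide step_prob_tendsto klim den[unfolded q_def]) auto
  obtain r0 where r0: "r = Suc r0" using r by (metis One_nat_def Suc_le_D)
  have "exp (- pi * x * (real r - 1) / sqrt 6) = q ^ r0"
    unfolding q_def r0 exp_of_nat_mult[symmetric] by simp
  hence "x * q ^ r / (x * q / (1 - q)) = (1 - exp (- pi * x / sqrt 6)) * exp (- pi * x * (real r - 1) / sqrt 6)"
    using q x by (simp add: r0 q_def)
  with lim have lim: "(\<lambda>n. sqrt (real n) * step_prob n (k n) r / (\<Sum>r'. 1 * (sqrt (real n) * step_prob n (k n) (Suc r'))))
     \<longlonglongrightarrow> (1 - exp (- pi * x / sqrt 6)) * exp (- pi * x * (real r - 1) / sqrt 6)" by (simp only:)
  show ?thesis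
  proof (rule Lim_transform_eventually[OF lim])
    show "\<forall>\<^sub>F n in sequentially.
        sqrt (real n) * step_prob n (k n) r / (\<Sum>r'. 1 * (sqrt (real n) * step_prob n (k n) (Suc r')))
        = \<P>(\<omega> in M. R \<Lambda> (j n) \<omega> = r \<bar> K \<Lambda> (j n) \<omega> = k n \<and> sum_mset (\<Lambda> (j n) \<omega>) = n)"
      using pos eventually_ge_at_top[of 1]
    proof eventually_elim
      case (elim n)
      have "(\<Sum>r'. 1 * (sqrt (real n) * step_prob n (k n) (Suc r'))) = sqrt (real n) * (\<Sum>r'. step_prob n (k n) (Suc r'))"
        using suminf_mult[OF summable_step_prob[OF elim(2) k]] by simp
      thus ?case using elim(2) by (simp add: cond_prob_K_R[OF elim(2,1) k r])
    qed
  qed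
qed

text \<open>The \<open>\<nu>\<close>-th moment of \<open>K R / sqrt n\<close> converges; only its finiteness matters for \<open>\<nu> > 1\<close>.\<close>

lemma KR_moment_tendsto:
  assumes pos: "\<forall>\<^sub>F n in sequentially. \<P>(\<omega> in M. sum_mset (\<Lambda> (j n) \<omega>) = n) > 0"
  defines "I \<equiv> \<lambda>\<nu>. \<integral>\<^sup>+y. ennreal (\<Sum>r. (y * real (Suc r)) ^ \<nu> * (y * exp (- pi * y / sqrt 6) ^ Suc r))
            * indicator {0<..} y \<partial>lborel"
  shows "(\<lambda>n. (\<integral>\<omega>. real (K \<Lambda> (j n) \<omega> * R \<Lambda> (j n) \<omega>) ^ \<nu> \<partial>cond_measure M \<Lambda> (j n) n) / sqrt (real n) ^ \<nu>)
      \<longlonglongrightarrow> enn2real (I \<nu>)"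
    and "\<forall>\<^sub>F n in sequentially. integrable (cond_measure M \<Lambda> (j n) n)
      (\<lambda>\<omega>. real (K \<Lambda> (j n) \<omega> * R \<Lambda> (j n) \<omega>) ^ \<nu>)"
proof -
  define F where "F = (\<lambda>n k r. (real (k * r) / sqrt (real n)) ^ \<nu>)"
  have F_eq: "F n k r = real (k * r) ^ \<nu> / sqrt (real n) ^ \<nu>" for n k r
    by (simp add: F_def power_divide)
  have bound: "F n k r \<le> 1 * (1 + real r * (real k / sqrt (real n))) ^ \<nu>" for n k r
    unfolding F_def mult_1 by (intro power_mono) (auto simp: mult.commute)
  have "(\<lambda>n. F n (nat \<lceil>y * sqrt (real n)\<rceil>) r) \<longlonglongrightarrow> (y * real r) ^ \<nu>" if "y > 0" for y r
  proof -
    have "(\<lambda>n. (real (nat \<lceil>y * sqrt (real n)\<rceil>) / sqrt (real n) * real r) ^ \<nu>) \<longlonglongrightarrow> (y * real r) ^ \<nu>"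
      by (intro tendsto_intros nat_ceiling_div_tendsto that)
    thus ?thesis unfolding F_def by simp
  qed
  hence lim: "AE y in lborel. y > 0 \<longrightarrow> (\<forall>r\<ge>1. (\<lambda>n. F n (nat \<lceil>y * sqrt (real n)\<rceil>) r) \<longlonglongrightarrow> (y * real r) ^ \<nu>)"
    by simp
  have nonneg: "F n k r \<ge> 0" for n k r by (simp add: F_def)
  note * = cond_expectation_tendsto[OF pos nonneg bound lim]
  show "(\<lambda>n. (\<integral>\<omega>. real (K \<Lambda> (j n) \<omega> * R \<Lambda> (j n) \<omega>) ^ \<nu> \<partial>cond_measure M \<Lambda> (j n) n) / sqrt (real n) ^ \<nu>)
      \<longlonglongrightarrow> enn2real (I \<nu>)"
    using *(1) unfolding F_eq I_def by simp
  have "(\<lambda>y. (y * real r) ^ \<nu>) \<in> borel_measurable borel" for r :: nat by measurable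
  from *(2)[OF this] show "\<forall>\<^sub>F n in sequentially. integrable (cond_measure M \<Lambda> (j n) n)
      (\<lambda>\<omega>. real (K \<Lambda> (j n) \<omega> * R \<Lambda> (j n) \<omega>) ^ \<nu>)"
    using eventually_ge_at_top[of 1]
  proof eventually_elim
    case (elim n)
    show ?case
      using integrable_mult_right[OF elim(1), of "sqrt (real n) ^ \<nu>"] elim(2) by (simp add: F_eq)
  qed
qed

lemma KR_mean_tendsto:
  assumes pos: "\<forall>\<^sub>F n in sequentially. \<P>(\<omega> in M. sum_mset (\<Lambda> (j n) \<omega>) = n) > 0"
  shows "(\<lambda>n. (\<integral>\<omega>. real (K \<Lambda> (j n) \<omega> * R \<Lambda> (j n) \<omega>) \<partial>cond_measure M \<Lambda> (j n) n) / sqrt (real n))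
          \<longlonglongrightarrow> 2 * sqrt 6 / pi"
  using KR_moment_tendsto(1)[OF pos, of 1] nn_integral_limit_mean
  by (simp del: of_nat_mult of_nat_Suc power_Suc)

lemma KR_moment_bigo:
  assumes pos: "\<forall>\<^sub>F n in sequentially. \<P>(\<omega> in M. sum_mset (\<Lambda> (j n) \<omega>) = n) > 0"
  shows "(\<lambda>n. \<integral>\<omega>. real (K \<Lambda> (j n) \<omega> * R \<Lambda> (j n) \<omega>) ^ \<nu> \<partial>cond_measure M \<Lambda> (j n) n)
          \<in> O(\<lambda>n. real n powr (real \<nu> / 2))"
proof (rule bigoI_tendsto)
  have "\<forall>\<^sub>F n in sequentially. sqrt (real n) ^ \<nu> = real n powr (real \<nu> / 2)"
    using eventually_gt_at_top[of 0]
  proof eventually_elim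
    case (elim n)
    have "sqrt (real n) ^ \<nu> = (real n powr (1 / 2)) powr real \<nu>"
      using elim by (simp add: powr_half_sqrt powr_realpow)
    thus ?case by (simp add: powr_powr)
  qed
  hence "\<forall>\<^sub>F n in sequentially.
      (\<integral>\<omega>. real (K \<Lambda> (j n) \<omega> * R \<Lambda> (j n) \<omega>) ^ \<nu> \<partial>cond_measure M \<Lambda> (j n) n) / sqrt (real n) ^ \<nu>
    = (\<integral>\<omega>. real (K \<Lambda> (j n) \<omega> * R \<Lambda> (j n) \<omega>) ^ \<nu> \<partial>cond_measure M \<Lambda> (j n) n) / real n powr (real \<nu> / 2)"
    by eventually_elim simp
  from Lim_transform_eventually[OF KR_moment_tendsto(1)[OF pos] this]
  show "(\<lambda>n. (\<integral>\<omega>. real (K \<Lambda> (j n) \<omega> * R \<Lambda> (j n) \<omega>) ^ \<nu> \<partial>cond_measure M \<Lambda> (j n) n) / real n powr (real \<nu> / 2))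
     \<longlonglongrightarrow> enn2real (\<integral>\<^sup>+y. ennreal (\<Sum>r. (y * real (Suc r)) ^ \<nu> * (y * exp (- pi * y / sqrt 6) ^ Suc r))
            * indicator {0<..} y \<partial>lborel)" .
  show "\<forall>\<^sub>F n in sequentially. real n powr (real \<nu> / 2) \<noteq> 0"
    using eventually_gt_at_top[of 0] by eventually_elim simp
qed

lemma R_truncated_mean_tendsto:
  assumes pos: "\<forall>\<^sub>F n in sequentially. \<P>(\<omega> in M. sum_mset (\<Lambda> (j n) \<omega>) = n) > 0" and x: "x > 0"
  shows "\<forall>\<^sub>F n in sequentially. integrable (cond_measure M \<Lambda> (j n) n)
        (\<lambda>\<omega>. real (R \<Lambda> (j n) \<omega>) * indicator {\<omega>. real (K \<Lambda> (j n) \<omega>) \<ge> x * sqrt (real n)} \<omega>)"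
    and "(\<lambda>n. \<integral>\<omega>. real (R \<Lambda> (j n) \<omega>) * indicator {\<omega>. real (K \<Lambda> (j n) \<omega>) \<ge> x * sqrt (real n)} \<omega>
               \<partial>cond_measure M \<Lambda> (j n) n)
          \<longlonglongrightarrow> sqrt 6 * x * exp (- pi * x / sqrt 6) / (pi * (1 - exp (- pi * x / sqrt 6)))
              - 6 * ln (1 - exp (- pi * x / sqrt 6)) / pi\<^sup>2"
proof -
  define F where "F = (\<lambda>n k r. real r * of_bool (x * sqrt (real n) \<le> real k))"
  have F_eq: "real (R \<Lambda> (j n) \<omega>) * indicator {\<omega>. real (K \<Lambda> (j n) \<omega>) \<ge> x * sqrt (real n)} \<omega>
      = F n (K \<Lambda> (j n) \<omega>) (R \<Lambda> (j n) \<omega>)" for n \<omega>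
    by (simp add: F_def indicator_def)
  \<comment> \<open>on \<open>k \<ge> x sqrt n\<close> the factor \<open>r\<close> is at most \<open>(r k / sqrt n) / x\<close>, of polynomial growth as required\<close>
  have bound: "F n k r \<le> 1 / x * (1 + real r * (real k / sqrt (real n))) ^ 1" if "n \<ge> 1" for n k r
  proof (cases "x * sqrt (real n) \<le> real k")
    case True
    hence "x \<le> real k / sqrt (real n)" using that by (simp add: field_simps)
    hence "real r * x \<le> real r * (real k / sqrt (real n))" by (intro mult_left_mono) auto
    hence "real r * x \<le> 1 + real r * (real k / sqrt (real n))" by linarith
    thus ?thesis using True x by (simp add: F_def field_simps)
  next
    case False
    thus ?thesis using x by (simp add: F_def)
  qed
  have nonneg: "F n k r \<ge> 0" for n k r by (simp add: F_def)
  \<comment> \<open>the indicators need not converge at the point \<open>y = x\<close>\<close>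
  have "AE y in lborel. y \<noteq> x" by (rule AE_lborel_singleton)
  hence lim: "AE y in lborel. y > 0 \<longrightarrow> (\<forall>r\<ge>1.
      (\<lambda>n. F n (nat \<lceil>y * sqrt (real n)\<rceil>) r) \<longlonglongrightarrow> real r * of_bool (x \<le> y))"
  proof eventually_elim
    case (elim y)
    show ?case
    proof (intro impI allI)
      fix r :: nat
      assume "y > 0"
      from eventually_nat_ceiling_iff[OF this elim]
      have "\<forall>\<^sub>F n in sequentially. F n (nat \<lceil>y * sqrt (real n)\<rceil>) r = real r * of_bool (x \<le> y)"
        by eventually_elim (simp add: F_def)
      thus "(\<lambda>n. F n (nat \<lceil>y * sqrt (real n)\<rceil>) r) \<longlonglongrightarrow> real r * of_bool (x \<le> y)"
        by (rule tendsto_eventually)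
    qed
  qed
  have meas: "(\<lambda>y. real r * of_bool (x \<le> y)) \<in> borel_measurable borel" for r :: nat by measurable
  note * = cond_expectation_tendsto[OF pos nonneg bound lim meas, folded F_eq]
  show "\<forall>\<^sub>F n in sequentially. integrable (cond_measure M \<Lambda> (j n) n)
        (\<lambda>\<omega>. real (R \<Lambda> (j n) \<omega>) * indicator {\<omega>. real (K \<Lambda> (j n) \<omega>) \<ge> x * sqrt (real n)} \<omega>)"
    by (rule *(2))
  show "(\<lambda>n. \<integral>\<omega>. real (R \<Lambda> (j n) \<omega>) * indicator {\<omega>. real (K \<Lambda> (j n) \<omega>) \<ge> x * sqrt (real n)} \<omega>
               \<partial>cond_measure M \<Lambda> (j n) n)
          \<longlonglongrightarrow> sqrt 6 * x * exp (- pi * x / sqrt 6) / (pi * (1 - exp (- pi * x / sqrt 6)))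
              - 6 * ln (1 - exp (- pi * x / sqrt 6)) / pi\<^sup>2"
    using *(1) nn_integral_limit_R[OF x] by simp
qed

end

theorem proposition3p8:
  fixes M :: "'a measure"
    and \<Lambda> :: "nat \<Rightarrow> 'a \<Rightarrow> nat multiset"
    and j :: "nat \<Rightarrow> nat"
  assumes chain: "partition_chain M \<Lambda>"
    and pos: "\<forall>\<^sub>F n in sequentially. \<P>(\<omega> in M. sum_mset (\<Lambda> (j n) \<omega>) = n) > 0"
  shows
    "(\<forall>x::real. x > 0 \<longrightarrow>
        (\<lambda>n. \<P>(\<omega> in M. real (K \<Lambda> (j n) \<omega>) \<le> x * sqrt (real n) \<bar> sum_mset (\<Lambda> (j n) \<omega>) = n))
          \<longlonglongrightarrow> integral {0..x} (\<lambda>y. y * exp (- pi * y / sqrt 6) / (1 - exp (- pi * y / sqrt 6))))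
     \<and>
     (\<forall>(x::real) (k :: nat \<Rightarrow> nat) (r::nat).
        x > 0 \<longrightarrow> (\<forall>n. k n \<ge> 1) \<longrightarrow> (\<lambda>n. real (k n) / sqrt (real n)) \<longlonglongrightarrow> x \<longrightarrow> r \<ge> 1 \<longrightarrow>
        (\<lambda>n. \<P>(\<omega> in M. R \<Lambda> (j n) \<omega> = r \<bar> K \<Lambda> (j n) \<omega> = k n \<and> sum_mset (\<Lambda> (j n) \<omega>) = n))
          \<longlonglongrightarrow> (1 - exp (- pi * x / sqrt 6)) * exp (- pi * x * (real r - 1) / sqrt 6))
     \<and>
     ((\<lambda>n. (\<integral>\<omega>. real (K \<Lambda> (j n) \<omega> * R \<Lambda> (j n) \<omega>) \<partial>cond_measure M \<Lambda> (j n) n) / sqrt (real n))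
          \<longlonglongrightarrow> 2 * sqrt 6 / pi)
     \<and>
     (\<forall>\<nu>::nat. \<nu> \<ge> 1 \<longrightarrow>
        (\<forall>\<^sub>F n in sequentially.
           integrable (cond_measure M \<Lambda> (j n) n) (\<lambda>\<omega>. real (K \<Lambda> (j n) \<omega> * R \<Lambda> (j n) \<omega>) ^ \<nu>)) \<and>
        (\<lambda>n. \<integral>\<omega>. real (K \<Lambda> (j n) \<omega> * R \<Lambda> (j n) \<omega>) ^ \<nu> \<partial>cond_measure M \<Lambda> (j n) n)
          \<in> O(\<lambda>n. real n powr (real \<nu> / 2)))
     \<and>
     (\<forall>x::real. x > 0 \<longrightarrow>
        (\<forall>\<^sub>F n in sequentially.
           integrable (cond_measure M \<Lambda> (j n) n)
             (\<lambda>\<omega>. real (R \<Lambda> (j n) \<omega>) * indicator {\<omega>. real (K \<Lambda> (j n) \<omega>) \<ge> x * sqrt (real n)} \<omega>)) \<and>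
        (\<lambda>n. \<integral>\<omega>. real (R \<Lambda> (j n) \<omega>) * indicator {\<omega>. real (K \<Lambda> (j n) \<omega>) \<ge> x * sqrt (real n)} \<omega>
               \<partial>cond_measure M \<Lambda> (j n) n)
          \<longlonglongrightarrow> sqrt 6 * x * exp (- pi * x / sqrt 6) / (pi * (1 - exp (- pi * x / sqrt 6)))
              - 6 * ln (1 - exp (- pi * x / sqrt 6)) / pi\<^sup>2)"
proof -
  interpret partition_chain M \<Lambda> by (rule chain)
  show ?thesis
    using K_distribution_tendsto[OF pos] R_conditional_tendsto[OF pos] KR_mean_tendsto[OF pos]
      KR_moment_tendsto(2)[OF pos] KR_moment_bigo[OF pos] R_truncated_mean_tendsto[OF pos]
    by (intro conjI allI impI) blast+
qed

end
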